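(* Let $E=\mathbb R^{p+q}$, $M=\mathbb R^p$, and let $\pi:E\to M$ be the canonical projection. For a natural number $n$, the mapping $\pi_{n+1,n}:\mathcal{J}^{n+1}(\pi)\rightarrow\mathcal{J}^{n}(\pi)$, equipped with the operations $\dot-$ and $\dot+$, is an affine bundle over the vector bundle $\mathcal{S}^{n+1}(\pi)\underset{E}{\times}\mathcal{J}^{n}(\pi)\rightarrow\mathcal{J}^{n}(\pi)$.
   Context: For an infinitesimal object $\mathbb D\ni0$ (a formal subset of some $\mathbb R^k$ cut out by polynomial equations), $\mathcal W_{\mathbb D}$ is its Weil algebra (quotient of $C^\infty(\mathbb R^k)$ by the ideal generated by the equations), and $\mathbb R^m\otimes\mathcal W_{\mathbb D}=(\mathcal W_{\mathbb D})^m$, whose elements are represented by (truncated Taylor) polynomial maps $\mathbb R^k\to\mathbb R^m$. A polynomial map $f:\mathbb D\to\mathbb D'$, $f(0)=0$, induces "composition with $f$", $\mathrm{id}\otimes\mathcal W_f:\mathbb R^m\otimes\mathcal W_{\mathbb D'}\to\mathbb R^m\otimes\mathcal W_{\mathbb D}$. $D(p)_n\subset\mathbb R^p$ is the set of $(d_1,\dots,d_p)$ all of whose products of $n+1$ coordinates (with repetition) vanish; $D(N)=D(N)_1$. Let $N=\binom{p+n}{n+1}$ (the paper writes ${}_{p+n}C_{n+1}$), the number of degree-$(n+1)$ monomials in $p$ variables. $\mathcal J^n(\pi)$ is the set of $\gamma\in E\otimes\mathcal W_{D(p)_n}$ such that $(\pi\otimes\mathrm{id})(\gamma)\in M\otimes\mathcal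 W_{D(p)_n}$ is degenerate (constant, i.e. comes from $M\otimes\mathcal W_1=M$ via $D(p)_n\to1=\{0\}$). $\mathcal S^{n+1}(\pi)$ is the set of $t\in E\otimes\mathcal W_{D(N)}$ such that $(\pi\otimes\mathrm{id})(t)$ is degenerate; it is a vector bundle over $E$. The map $\pi_{n+1,n}:\mathcal J^{n+1}(\pi)\to\mathcal J^n(\pi)$ is restriction along $D(p)_n\subset D(p)_{n+1}$. Put $D(p)_{n+1}\oplus D(N)=\{(d,e)\in D(p)_{n+1}\times D(N): d_ie_k=0\ \forall i,k\}$, with canonical injections $\Phi:D(p)_{n+1}\to D(p)_{n+1}\oplus D(N)$, $\Xi:D(N)\to D(p)_{n+1}\oplus D(N)$, and $\Psi(d)=(d,(d_{i_1}\cdots d_{i_{n+1}})_{1\le i_1\le\dots\le i_{n+1}\le p})$. If $\gamma_\pm\in E\otimes\mathcal W_{D(p)_{n+1}}$ agree on $D(p)_n$, there is a unique $\gamma\in E\otimes\mathcal W_{D(p)_{n+1}\oplus D(N)}$ whose compositions with $\Psi,\Phi$ are $\gamma_+,\gamma_-$; $\gamma_+\dot-\gamma_-$ is its composition with $\Xi$. If $t\in E\otimes\mathcal W_{D(N)}$ and $\gamma\in E\otimes\mathcal W_{D(p)_{n+1}}$ have the same base point, there is a unique $\gamma'$ whose compositions with $\Xi,\Phi$ are $t,\gamma$; $t\dot+\gamma$ is its composition with $\Psi$. In coordinates, an element of $\mathcal J^{n+1}(\pi)$ is a tuple $(x^i,u^j,u^j_{i_1},\dots,u^j_{i_1,\dots,i_{n+1}})$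 ($1\le i\le p$, $1\le j\le q$, $1\le i_1\le i_2\le\dots\le p$) of Taylor coefficients, an element of $\mathcal S^{n+1}(\pi)$ is a tuple $(x^i,u^j,u^j_{i_1,\dots,i_{n+1}})$, and $\dot-$, $\dot+$ subtract, respectively add, the coefficients of order $n+1$. Affine bundle. $A\to B$ is an affine bundle over a vector bundle $V\to B$ if each fibre $A_b$ is an affine space over $V_b$: with the given operations, $(a\dot-a')\dot+a'=a$, $(v\dot+a)\dot-a=v$, $0\dot+a=a$, $v\dot+(w\dot+a)=(v+w)\dot+a$. *)

theory Defs
  imports "HOL-Analysis.Analysis" "HOL-Algebra.QuotRing" "HOL-Algebra.Module" "HOL-Library.Multiset"
begin

section \<open>Weil algebras\<close>

text \<open>\<open>Ck k f\<close>: all iterated directional derivatives of \<open>f\<close> of order less than \<open>k\<close> are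
  differentiable everywhere, and those of order \<open>k\<close> are continuous.\<close>

primrec Ck :: "nat \<Rightarrow> ('a::real_normed_vector \<Rightarrow> real) \<Rightarrow> bool" where
  "Ck 0 f \<longleftrightarrow> continuous_on UNIV f"
| "Ck (Suc k) f \<longleftrightarrow> (\<forall>x. f differentiable (at x)) \<and>
     (\<forall>v. Ck k (\<lambda>x. frechet_derivative f (at x) v))"

definition smooth :: "('a::real_normed_vector \<Rightarrow> real) \<Rightarrow> bool" where
  "smooth f \<longleftrightarrow> (\<forall>k. Ck k f)"

definition Cinf :: "('a::euclidean_space \<Rightarrow> real) ring" where
  "Cinf = \<lparr>carrier = {f. smooth f}, mult = (\<lambda>f g x. f x * g x), one = (\<lambda>_. 1),
           zero = (\<lambda>_. 0), add = (\<lambda>f g x. f x + g x)\<rparr>"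

text \<open>An infinitesimal object in the Euclidean space \<open>'a\<close> has no points besides \<open>0\<close>; it is
  represented by the set \<open>G\<close> of the left-hand sides of its defining equations \<open>g = 0\<close>.\<close>

definition weil_ideal :: "('a::euclidean_space \<Rightarrow> real) set \<Rightarrow> ('a \<Rightarrow> real) set" where
  "weil_ideal G = Idl\<^bsub>Cinf\<^esub> G"

definition weil :: "('a::euclidean_space \<Rightarrow> real) set \<Rightarrow> ('a \<Rightarrow> real) set ring" where
  "weil G = Cinf Quot weil_ideal G"

definition weil_class :: "('a::euclidean_space \<Rightarrow> real) set \<Rightarrow> ('a \<Rightarrow> real) \<Rightarrow> ('a \<Rightarrow> real) set" where
  "weil_class G f = weil_ideal G +>\<^bsub>Cinf\<^esub> f"

text \<open>For \<open>f\<close> mapping the object with equations \<open>G\<close> into the one with equations \<open>H\<close>, the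
  homomorphism from \<open>weil H\<close> to \<open>weil G\<close> sending the class of \<open>g\<close> to that of \<open>g \<circ> f\<close>.
  All the sets in the union are equal, so \<open>H\<close> does not occur.\<close>

definition weil_map ::
  "('a::euclidean_space \<Rightarrow> real) set \<Rightarrow> ('a \<Rightarrow> 'b) \<Rightarrow> ('b::euclidean_space \<Rightarrow> real) set \<Rightarrow> ('a \<Rightarrow> real) set"
  where "weil_map G f X = (\<Union>g\<in>X. weil_class G (g \<circ> f))"

text \<open>\<open>weil_points G\<close> is the tensor product of \<open>real ^ 'm\<close> with \<open>weil G\<close>, that is,
  \<open>(weil G) ^ 'm\<close>.\<close>

type_synonym ('a, 'm) weil_point = "(('a \<Rightarrow> real) set) ^ 'm"

definition weil_points :: "('a::euclidean_space \<Rightarrow> real) set \<Rightarrow> ('a, 'm::finite) weil_point set" where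
  "weil_points G = {\<gamma>. \<forall>i. \<gamma> $ i \<in> carrier (weil G)}"

definition pull :: "('a::euclidean_space \<Rightarrow> real) set \<Rightarrow> ('a \<Rightarrow> 'b) \<Rightarrow>
    ('b::euclidean_space, 'm::finite) weil_point \<Rightarrow> ('a, 'm) weil_point" where
  "pull G f \<gamma> = (\<chi> i. weil_map G f (\<gamma> $ i))"

definition const_point :: "('a::euclidean_space \<Rightarrow> real) set \<Rightarrow> real ^ 'm::finite \<Rightarrow> ('a, 'm) weil_point" where
  "const_point G x = (\<chi> i. weil_class G (\<lambda>_. x $ i))"

definition degenerate :: "('a::euclidean_space \<Rightarrow> real) set \<Rightarrow> ('a, 'm::finite) weil_point \<Rightarrow> bool" where
  "degenerate G \<gamma> \<longleftrightarrow> (\<exists>x. \<gamma> = const_point G x)"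

text \<open>All representatives have the same value at \<open>0\<close>, since the defining equations hold there.\<close>

definition base_point :: "('a::euclidean_space, 'm::finite) weil_point \<Rightarrow> real ^ 'm" where
  "base_point \<gamma> = (\<chi> i. THE r. \<forall>g\<in>\<gamma> $ i. g 0 = r)"

section \<open>Infinitesimal objects\<close>

text \<open>\<open>D_eqs n\<close> cuts out \<open>D(p)\<^sub>n\<close>, where \<open>p = CARD('p)\<close>: the products of \<open>n + 1\<close> coordinates,
  with repetition, are indexed by the multisets of size \<open>n + 1\<close>.\<close>

definition monomial :: "'p multiset \<Rightarrow> real ^ 'p::finite \<Rightarrow> real" where
  "monomial A d = (\<Prod>i\<in>#A. d $ i)"

definition D_eqs :: "nat \<Rightarrow> (real ^ 'p::finite \<Rightarrow> real) set" where
  "D_eqs n = {monomial A | A. size A = Suc n}"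

definition oplus :: "(real ^ 'p::finite \<Rightarrow> real) set \<Rightarrow> (real ^ 'k::finite \<Rightarrow> real) set \<Rightarrow>
    ((real ^ 'p) \<times> (real ^ 'k) \<Rightarrow> real) set" where
  "oplus G H = {g \<circ> fst | g. g \<in> G} \<union> {h \<circ> snd | h. h \<in> H} \<union>
     {\<lambda>(d, e). d $ i * e $ j | i j. True}"

definition inj1 :: "real ^ 'p::finite \<Rightarrow> (real ^ 'p) \<times> (real ^ 'k::finite)" where
  "inj1 d = (d, 0)"

definition inj2 :: "real ^ 'k::finite \<Rightarrow> (real ^ 'p::finite) \<times> (real ^ 'k)" where
  "inj2 e = (0, e)"

text \<open>An enumeration \<open>\<iota>\<close> of the monomials of degree \<open>n + 1\<close> by the coordinates of \<open>real ^ 'k\<close>.\<close>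

definition monomial_enum :: "nat \<Rightarrow> ('k::finite \<Rightarrow> 'p::finite multiset) \<Rightarrow> bool" where
  "monomial_enum n \<iota> \<longleftrightarrow> bij_betw \<iota> UNIV {A. size A = Suc n}"

lemma monomial_enum_card:
  fixes \<iota> :: "'k::finite \<Rightarrow> 'p::finite multiset"
  assumes "monomial_enum n \<iota>"
  shows "CARD('k) = (CARD('p) + n) choose (n + 1)"
proof -
  have "{A :: 'p multiset. size A = Suc n} = multisets_of_size UNIV (Suc n)"
    by (auto simp: multisets_of_size_def)
  then show ?thesis
    using bij_betw_same_card[OF assms[unfolded monomial_enum_def]]
    by (simp add: card_multisets_of_size)
qed

definition Psi :: "('k::finite \<Rightarrow> 'p::finite multiset) \<Rightarrow> real ^ 'p \<Rightarrow> (real ^ 'p) \<times> (real ^ 'k)" where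
  "Psi \<iota> d = (d, \<chi> k. monomial (\<iota> k) d)"

section \<open>The spaces over the projection\<close>

text \<open>Used with \<open>'c = real\<close>, \<open>proj\<close> is the projection from \<open>real ^ ('p + 'q)\<close> to \<open>real ^ 'p\<close>;
  on Weil points it is that projection tensored with the identity of the Weil algebra.\<close>

definition proj :: "'c ^ ('p::finite + 'q::finite) \<Rightarrow> 'c ^ 'p" where
  "proj x = (\<chi> i. x $ Inl i)"

definition jet :: "nat \<Rightarrow> (real ^ 'p::finite, 'p + 'q::finite) weil_point set" where
  "jet n = {\<gamma> \<in> weil_points (D_eqs n). degenerate (D_eqs n) (proj \<gamma>)}"

definition jet_restrict :: "nat \<Rightarrow> (real ^ 'p::finite, 'p + 'q::finite) weil_point \<Rightarrow>
    (real ^ 'p, 'p + 'q) weil_point" where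
  "jet_restrict n = pull (D_eqs n) (\<lambda>d. d)"

definition symb :: "(real ^ 'k::finite, 'p::finite + 'q::finite) weil_point set" where
  "symb = {t \<in> weil_points (D_eqs 1). degenerate (D_eqs 1) (proj t)}"

text \<open>The point on \<open>D \<oplus> D'\<close> with prescribed restrictions along the two injections.\<close>

definition glue :: "(real ^ 'p::finite \<Rightarrow> real) set \<Rightarrow> (real ^ 'k::finite \<Rightarrow> real) set \<Rightarrow>
    (real ^ 'p, 'm::finite) weil_point \<Rightarrow> (real ^ 'k, 'm) weil_point \<Rightarrow>
    ((real ^ 'p) \<times> (real ^ 'k), 'm) weil_point" where
  "glue G H \<gamma> t = (THE \<delta>. \<delta> \<in> weil_points (oplus G H) \<and> pull G inj1 \<delta> = \<gamma> \<and> pull H inj2 \<delta> = t)"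

definition jet_add :: "nat \<Rightarrow> ('k::finite \<Rightarrow> 'p::finite multiset) \<Rightarrow>
    (real ^ 'k, 'm::finite) weil_point \<Rightarrow> (real ^ 'p, 'm) weil_point \<Rightarrow> (real ^ 'p, 'm) weil_point" where
  "jet_add n \<iota> t \<gamma> = pull (D_eqs (Suc n)) (Psi \<iota>) (glue (D_eqs (Suc n)) (D_eqs 1) \<gamma> t)"

definition jet_diff :: "nat \<Rightarrow> ('k::finite \<Rightarrow> 'p::finite multiset) \<Rightarrow>
    (real ^ 'p, 'm::finite) weil_point \<Rightarrow> (real ^ 'p, 'm) weil_point \<Rightarrow> (real ^ 'k, 'm) weil_point" where
  "jet_diff n \<iota> \<gamma>p \<gamma>m = pull (D_eqs 1) inj2
     (THE \<delta>. \<delta> \<in> weil_points (oplus (D_eqs (Suc n)) (D_eqs 1)) \<and>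
        pull (D_eqs (Suc n)) (Psi \<iota>) \<delta> = \<gamma>p \<and> pull (D_eqs (Suc n)) inj1 \<delta> = \<gamma>m)"

text \<open>The linear structure on the fibres of \<open>symb\<close> over the total space is the one of tangent
  vectors: \<open>(t + t') d = s (d, d)\<close> for \<open>s\<close> restricting to \<open>t\<close> and \<open>t'\<close> on the two axes, and
  \<open>(a t) d = t (a d)\<close>. In coordinates both act on the coefficients of order one.\<close>

definition symb_add :: "(real ^ 'k::finite, 'm::finite) weil_point \<Rightarrow> (real ^ 'k, 'm) weil_point \<Rightarrow>
    (real ^ 'k, 'm) weil_point" where
  "symb_add t t' = pull (D_eqs 1) (\<lambda>d. (d, d)) (glue (D_eqs 1) (D_eqs 1) t t')"

definition symb_scale :: "real \<Rightarrow> (real ^ 'k::finite, 'm::finite) weil_point \<Rightarrow>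
    (real ^ 'k, 'm) weil_point" where
  "symb_scale a t = pull (D_eqs 1) (\<lambda>d. a *\<^sub>R d) t"

section \<open>Affine bundles\<close>

definition real_ring :: "real ring" where
  "real_ring = \<lparr>carrier = UNIV, mult = (*), one = 1, zero = 0, add = (+)\<rparr>"

definition fibre :: "'a set \<Rightarrow> ('a \<Rightarrow> 'b) \<Rightarrow> 'b \<Rightarrow> 'a set" where
  "fibre T pr b = {a \<in> T. pr a = b}"

text \<open>Both notions of bundle are fibrewise; no local triviality is involved. The fields
  \<open>mult\<close> and \<open>one\<close> of a module record carry no meaning.\<close>

definition vector_bundle :: "'v set \<Rightarrow> ('v \<Rightarrow> 'b) \<Rightarrow> 'b set \<Rightarrow> ('b \<Rightarrow> (real, 'v) module) \<Rightarrow> bool" where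
  "vector_bundle T pr B V \<longleftrightarrow> pr \<in> T \<rightarrow> B \<and>
     (\<forall>b\<in>B. carrier (V b) = fibre T pr b \<and> Module.module real_ring (V b))"

definition affine_space :: "(real, 'v) module \<Rightarrow> 'a set \<Rightarrow> ('a \<Rightarrow> 'a \<Rightarrow> 'v) \<Rightarrow> ('v \<Rightarrow> 'a \<Rightarrow> 'a) \<Rightarrow> bool" where
  "affine_space V A sub ad \<longleftrightarrow>
     A \<noteq> {} \<and>
     (\<forall>a\<in>A. \<forall>a'\<in>A. sub a a' \<in> carrier V) \<and>
     (\<forall>v\<in>carrier V. \<forall>a\<in>A. ad v a \<in> A) \<and>
     (\<forall>a\<in>A. \<forall>a'\<in>A. ad (sub a a') a' = a) \<and>
     (\<forall>v\<in>carrier V. \<forall>a\<in>A. sub (ad v a) a = v) \<and>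
     (\<forall>a\<in>A. ad \<zero>\<^bsub>V\<^esub> a = a) \<and>
     (\<forall>v\<in>carrier V. \<forall>w\<in>carrier V. \<forall>a\<in>A. ad v (ad w a) = ad (v \<oplus>\<^bsub>V\<^esub> w) a)"

definition affine_bundle :: "'a set \<Rightarrow> ('a \<Rightarrow> 'b) \<Rightarrow> 'v set \<Rightarrow> ('v \<Rightarrow> 'b) \<Rightarrow> 'b set \<Rightarrow>
    ('b \<Rightarrow> (real, 'v) module) \<Rightarrow> ('a \<Rightarrow> 'a \<Rightarrow> 'v) \<Rightarrow> ('v \<Rightarrow> 'a \<Rightarrow> 'a) \<Rightarrow> bool" where
  "affine_bundle A prA T prT B V sub ad \<longleftrightarrow>
     vector_bundle T prT B V \<and> prA \<in> A \<rightarrow> B \<and>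
     (\<forall>b\<in>B. affine_space (V b) (fibre A prA b) sub ad)"

section \<open>The bundle of symbols pulled back to jets\<close>

definition symb_jet :: "nat \<Rightarrow>
    ((real ^ 'k::finite, 'p::finite + 'q::finite) weil_point \<times> (real ^ 'p, 'p + 'q) weil_point) set" where
  "symb_jet n = {(t, \<gamma>). t \<in> symb \<and> \<gamma> \<in> jet n \<and> base_point t = base_point \<gamma>}"

definition symb_jet_fibre :: "nat \<Rightarrow> (real ^ 'p::finite, 'p + 'q::finite) weil_point \<Rightarrow>
    (real, (real ^ 'k::finite, 'p + 'q) weil_point \<times> (real ^ 'p, 'p + 'q) weil_point) module" where
  "symb_jet_fibre n \<gamma> = \<lparr>carrier = fibre (symb_jet n) snd \<gamma>, mult = undefined, one = undefined,
     zero = (const_point (D_eqs 1) (base_point \<gamma>), \<gamma>),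
     add = (\<lambda>v w. (symb_add (fst v) (fst w), \<gamma>)),
     smult = (\<lambda>a v. (symb_scale a (fst v), \<gamma>))\<rparr>"

end

theory Submission
  imports Defs
begin

text \<open>By Hadamard's lemma with parameters, a smooth function on \<open>D(p)\<^sub>n\<^sub>+\<^sub>1 \<oplus> D(N)\<close> is determined by
  its restrictions to the two summands, so that gluing the classes of \<open>g\<close> and \<open>h\<close> gives the class of
  \<open>g d + h e - g 0\<close>. Composing with \<open>\<Psi>\<close>, the sum of \<open>h\<close> and \<open>g\<close> is the class of
  \<open>g d + h (m d) - g 0\<close>, where \<open>m\<close> lists the monomials of degree \<open>n + 1\<close>; on such representatives the
  identities of an affine space hold on the nose or modulo squares. The difference is well defined because
  the monomials of degree \<open>n + 1\<close> are linearly independent modulo the equations of \<open>D(p)\<^sub>n\<^sub>+\<^sub>1\<close>, and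
  it exists because a smooth function vanishing on \<open>D(p)\<^sub>n\<close> agrees on \<open>D(p)\<^sub>n\<^sub>+\<^sub>1\<close> with a
  linear combination of these monomials.\<close>

section \<open>Smooth functions\<close>

text \<open>The operations are definite descriptions on classes modulo ideals of smooth functions,
  so no value can be computed before uniqueness is known. Uniqueness means that a function on the
  sum object lies in its ideal as soon as two of its pullbacks lie in theirs:
  \<open>oplus_ideal_memI\<close> is this criterion for \<open>inj1\<close> and \<open>inj2\<close>,
  \<open>Psi_ideal_memI\<close> for \<open>inj1\<close> and \<open>Psi\<close>. Membership means
  being a combination of the equations with smooth coefficients, so every expansion has to deliver
  smooth remainders; these are integrals with parameters. The difference of two jets is never
  evaluated from its description. A symbol whose sum with one jet is the other is written down, and
  cancellation then names the difference: the point glued for the sum is the very point described in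
  the difference. Representatives are chosen so that components over the base are literal constants,
  which survive every operation, and so that values at \<open>0\<close> stay explicit, since the
  constant term common to two summands has to be removed once from each sum.\<close>

lemma Ck_SucI:
  assumes "\<And>x. (f has_derivative f' x) (at x)" and "\<And>v. Ck k (\<lambda>x. f' x v)"
  shows "Ck (Suc k) f"
proof -
  have "frechet_derivative f (at x) = f' x" for x
    using frechet_derivative_at[OF assms(1)] by metis
  then show ?thesis
    using assms by (auto simp: differentiable_def)
qed

lemma Ck_Suc_derivative:
  assumes "Ck (Suc k) f"
  shows "(f has_derivative frechet_derivative f (at x)) (at x)"
  using assms frechet_derivative_works by auto

lemma Ck_Suc_imp_Ck: "Ck (Suc k) f \<Longrightarrow> Ck k f"
proof (induction k arbitrary: f)
  case 0
  then show ?case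
    by (auto intro!: continuous_at_imp_continuous_on differentiable_imp_continuous_within)
qed auto

lemma Ck_imp_continuous_on: "Ck k f \<Longrightarrow> continuous_on UNIV f"
proof (induction k)
  case (Suc k)
  then show ?case using Ck_Suc_imp_Ck by blast
qed simp

lemma Ck_const: "Ck k (\<lambda>_. c)"
proof (induction k arbitrary: c)
  case (Suc k)
  then show ?case
    by (intro Ck_SucI[where f' = "\<lambda>_ _. 0"]) auto
qed simp

lemma Ck_bounded_linear: "bounded_linear f \<Longrightarrow> Ck k f"
proof (cases k)
  case 0
  assume "bounded_linear f"
  then show ?thesis
    using 0 by (simp add: linear_continuous_on)
next
  case (Suc m)
  assume "bounded_linear f"
  then show ?thesis
    unfolding Suc
    by (intro Ck_SucI[where f' = "\<lambda>_. f"] bounded_linear_imp_has_derivative Ck_const)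
qed

lemma Ck_add: "Ck k f \<Longrightarrow> Ck k g \<Longrightarrow> Ck k (\<lambda>x. f x + g x)"
proof (induction k arbitrary: f g)
  case 0
  then show ?case by (auto intro: continuous_on_add)
next
  case (Suc k)
  then show ?case
    by (intro Ck_SucI[OF has_derivative_add[OF Ck_Suc_derivative Ck_Suc_derivative]]) auto
qed

lemma Ck_mult: "Ck k f \<Longrightarrow> Ck k g \<Longrightarrow> Ck k (\<lambda>x. f x * g x)"
proof (induction k arbitrary: f g)
  case 0
  then show ?case by (auto intro: continuous_on_mult)
next
  case (Suc k)
  note f = Ck_Suc_derivative[OF Suc.prems(1)] Ck_Suc_imp_Ck[OF Suc.prems(1)]
    and g = Ck_Suc_derivative[OF Suc.prems(2)] Ck_Suc_imp_Ck[OF Suc.prems(2)]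
  show ?case
  proof (rule Ck_SucI[OF has_derivative_mult[OF f(1) g(1)]])
    show "Ck k (\<lambda>x. f x * frechet_derivative g (at x) v + frechet_derivative f (at x) v * g x)" for v
      using Suc.prems by (intro Ck_add Suc.IH f g) simp_all
  qed
qed

lemma Ck_sum: "(\<And>i. i \<in> I \<Longrightarrow> Ck k (f i)) \<Longrightarrow> Ck k (\<lambda>x. \<Sum>i\<in>I. f i x)"
  by (induction I rule: infinite_finite_induct) (auto intro: Ck_add Ck_const)

text \<open>By the chain rule a derivative of the composite is a sum of products of derivatives of
  the components of \<open>f\<close> with partial derivatives of \<open>h\<close> composed with the
  same \<open>f\<close>. Hence the induction varies \<open>h\<close> and keeps \<open>f\<close>
  fixed. Regularity of \<open>f\<close> is stated by components because \<open>Ck\<close> speaks of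
  real-valued functions only.\<close>

lemma Ck_compose:
  fixes f :: "'a::real_normed_vector \<Rightarrow> 'b::euclidean_space"
  assumes "Ck k h" and "\<And>b. b \<in> Basis \<Longrightarrow> Ck k (\<lambda>x. f x \<bullet> b)"
  shows "Ck k (\<lambda>x. h (f x))"
  using assms
proof (induction k arbitrary: h)
  case 0
  then have "continuous_on UNIV f"
    by (subst continuous_on_componentwise) auto
  then show ?case
    using 0 continuous_on_compose2[of UNIV h UNIV f] by simp
next
  case (Suc k)
  define f' where "f' x v = (\<Sum>b\<in>Basis. frechet_derivative (\<lambda>x. f x \<bullet> b) (at x) v *\<^sub>R b)" for x v
  have f': "(f has_derivative f' x) (at x)" for x
    unfolding has_derivative_componentwise_within[of f]
  proof
    fix b :: 'b
    assume b: "b \<in> Basis"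
    then have "f' x v \<bullet> b = frechet_derivative (\<lambda>x. f x \<bullet> b) (at x) v" for v
      by (simp add: f'_def inner_sum_left inner_Basis if_distrib cong: if_cong)
    then show "((\<lambda>x. f x \<bullet> b) has_derivative (\<lambda>v. f' x v \<bullet> b)) (at x)"
      using Ck_Suc_derivative[OF Suc.prems(2)[OF b]] by simp
  qed
  show ?case
  proof (rule Ck_SucI)
    show "((\<lambda>x. h (f x)) has_derivative (\<lambda>v. frechet_derivative h (at (f x)) (f' x v))) (at x)" for x
      by (rule has_derivative_compose[OF f' Ck_Suc_derivative[OF Suc.prems(1)]])
    fix v
    have "frechet_derivative h (at (f x)) (f' x v) =
        (\<Sum>b\<in>Basis. frechet_derivative (\<lambda>x. f x \<bullet> b) (at x) v * frechet_derivative h (at (f x)) b)" for x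
    proof -
      interpret bounded_linear "frechet_derivative h (at (f x))"
        using Ck_Suc_derivative[OF Suc.prems(1)] by (rule has_derivative_bounded_linear)
      show ?thesis by (simp add: f'_def sum scaleR)
    qed
    moreover have "Ck k (\<lambda>x. \<Sum>b\<in>Basis. frechet_derivative (\<lambda>x. f x \<bullet> b) (at x) v *
        frechet_derivative h (at (f x)) b)"
    proof (intro Ck_sum Ck_mult)
      fix b :: 'b
      assume b: "b \<in> Basis"
      show "Ck k (\<lambda>x. frechet_derivative (\<lambda>x. f x \<bullet> b) (at x) v)"
        using Suc.prems(2)[OF b] by simp
      show "Ck k (\<lambda>x. frechet_derivative h (at (f x)) b)"
        using Suc.prems(1) Ck_Suc_imp_Ck[OF Suc.prems(2)]
        by (intro Suc.IH[of "\<lambda>y. frechet_derivative h (at y) b"]) simp_all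
    qed
    ultimately show "Ck k (\<lambda>x. frechet_derivative h (at (f x)) (f' x v))"
      by simp
  qed
qed

text \<open>Differentiation under the integral sign. The inner derivative
  \<open>P v + t *\<^sub>R Q v\<close> produces a further factor \<open>t\<close>, so the weight
  \<open>t ^ m\<close> is what closes the induction. The coefficients in Hadamard's lemma are the
  case \<open>m = 0\<close>.\<close>

lemma Ck_integral:
  fixes f :: "'a::euclidean_space \<Rightarrow> real" and P Q :: "'a \<Rightarrow> 'a"
  assumes "bounded_linear P" "bounded_linear Q" "Ck k f"
  shows "Ck k (\<lambda>x. integral {0..1::real} (\<lambda>t. t ^ m * f (P x + t *\<^sub>R Q x)))"
proof -
  have cont: "continuous_on S (\<lambda>z. P (a z))" "continuous_on S (\<lambda>z. Q (a z))"
    if "continuous_on S a" for S and a :: "'z::topological_space \<Rightarrow> 'a"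
    using assms(1,2) that by (auto intro: bounded_linear.continuous_on)
  show ?thesis
    using assms(3)
  proof (induction k arbitrary: f m)
    case 0
    then have "continuous_on UNIV f"
      by simp
    then have "continuous_on (UNIV \<times> cbox 0 1) (\<lambda>(x, t). t ^ m * f (P x + t *\<^sub>R Q x))"
      unfolding case_prod_beta
      by (intro continuous_on_mult continuous_on_compose2[of UNIV f _ "\<lambda>z. P (fst z) + snd z *\<^sub>R Q (fst z)"]
          cont continuous_intros) auto
    from integral_continuous_on_param[OF this] show ?case by simp
  next
    case (Suc k)
    let ?D = "\<lambda>x. frechet_derivative f (at x)"
    let ?y = "\<lambda>x t. P x + t *\<^sub>R Q x"
    define g where "g x t v = t ^ m * ?D (?y x t) (P v + t *\<^sub>R Q v)" for x t v
    have y: "((\<lambda>x. ?y x t) has_derivative (\<lambda>v. ?y v t)) (at x)" for x t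
      using assms(1,2)
      by (auto intro!: derivative_eq_intros simp: bounded_linear_imp_has_derivative)
    have g: "((\<lambda>x. t ^ m * f (?y x t)) has_derivative g x t) (at x)" for x t
      unfolding g_def
      by (intro has_derivative_mult_right has_derivative_compose[OF y Ck_Suc_derivative[OF Suc.prems]])
    have bl: "bounded_linear (g x t)" for x t
      using g by (rule has_derivative_bounded_linear)
    have D: "linear (?D x)" for x
      using Ck_Suc_derivative[OF Suc.prems] has_derivative_linear by blast
    have split: "g x t v = t ^ m * ?D (?y x t) (P v) + t ^ Suc m * ?D (?y x t) (Q v)" for x t v
      unfolding g_def by (simp add: linear_add[OF D] linear_scale[OF D] algebra_simps)
    have contD: "continuous_on UNIV (\<lambda>x. ?D x v)" for v
      using Suc.prems Ck_imp_continuous_on by auto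
    have contDy: "continuous_on S (\<lambda>z. ?D (?y (a z) (b z)) v)"
      if "continuous_on S a" "continuous_on S b" for S v and a :: "'z::topological_space \<Rightarrow> _" and b
      using that assms(1,2)
      by (intro continuous_on_compose2[OF contD] continuous_intros
        bounded_linear.continuous_on[of P] bounded_linear.continuous_on[of Q]) auto
    have contf: "continuous_on UNIV f"
      using Suc.prems Ck_imp_continuous_on by blast
    have int: "(\<lambda>t. t ^ m * f (?y x t)) integrable_on cbox 0 1" for x
      by (intro integrable_continuous continuous_intros continuous_on_compose2[OF contf]) auto
    have intD: "(\<lambda>t. t ^ j * ?D (?y x t) v) integrable_on cbox 0 1" for x j v
      by (intro integrable_continuous continuous_on_mult contDy continuous_intros)
    \<comment> \<open>The Leibniz rule asks for a derivative that is continuous with values in the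
      bounded linear maps. In finite dimension it is enough to check this on each basis
      vector.\<close>
    have cont: "continuous_on (UNIV \<times> cbox 0 1) (\<lambda>(x, t). Blinfun (g x t))"
      unfolding case_prod_beta
      by (rule continuous_on_blinfun_componentwise)
        (auto simp: bounded_linear_Blinfun_apply bl split intro!: continuous_on_add continuous_on_mult contDy continuous_intros)
    have intB: "(\<lambda>t. Blinfun (g x t)) integrable_on cbox 0 1" for x
      by (intro integrable_continuous continuous_on_blinfun_componentwise)
        (auto simp: bounded_linear_Blinfun_apply bl split
          intro!: continuous_on_add continuous_on_mult contDy continuous_intros)
    have L: "((\<lambda>x. integral (cbox 0 1) (\<lambda>t. t ^ m * f (?y x t))) has_derivative
        integral (cbox 0 1) (\<lambda>t. Blinfun (g x t))) (at x)" for x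
      using leibniz_rule[OF _ int cont UNIV_I convex_UNIV] g
      by (auto simp: bounded_linear_Blinfun_apply bl)
    have "blinfun_apply (integral (cbox 0 1) (\<lambda>t. Blinfun (g x t))) v =
        integral (cbox 0 1) (\<lambda>t. t ^ m * ?D (?y x t) (P v)) +
        integral (cbox 0 1) (\<lambda>t. t ^ Suc m * ?D (?y x t) (Q v))" for x v
      unfolding blinfun_apply_integral[OF intB, of x v] integral_add[OF intD intD, symmetric]
      by (simp add: bounded_linear_Blinfun_apply bl split)
    note integral_eq = this[unfolded cbox_interval]
    show ?case
    proof (rule Ck_SucI[OF L[unfolded cbox_interval]])
      show "Ck k (\<lambda>x. blinfun_apply (integral {0..1} (\<lambda>t. Blinfun (g x t))) v)" for v
        unfolding integral_eq using Suc.prems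
        by (intro Ck_add Suc.IH[of "\<lambda>x. ?D x (P v)"] Suc.IH[of "\<lambda>x. ?D x (Q v)"]) simp_all
    qed
  qed
qed

lemma smooth_const [simp]: "smooth (\<lambda>_. c)"
  by (simp add: smooth_def Ck_const)

lemma smooth_bounded_linear: "bounded_linear f \<Longrightarrow> smooth f"
  by (simp add: smooth_def Ck_bounded_linear)

lemma smooth_add: "smooth f \<Longrightarrow> smooth g \<Longrightarrow> smooth (\<lambda>x. f x + g x)"
  by (simp add: smooth_def Ck_add)

lemma smooth_mult: "smooth f \<Longrightarrow> smooth g \<Longrightarrow> smooth (\<lambda>x. f x * g x)"
  by (simp add: smooth_def Ck_mult)

lemma smooth_diff: "smooth f \<Longrightarrow> smooth g \<Longrightarrow> smooth (\<lambda>x. f x - g x)"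
  using smooth_add[of f, OF _ smooth_mult[OF smooth_const[of "-1"], of g]] by simp

lemma smooth_sum: "(\<And>i. i \<in> I \<Longrightarrow> smooth (f i)) \<Longrightarrow> smooth (\<lambda>x. \<Sum>i\<in>I. f i x)"
  by (simp add: smooth_def Ck_sum)

lemma smooth_imp_continuous_on: "smooth f \<Longrightarrow> continuous_on UNIV f"
  using Ck_imp_continuous_on smooth_def by blast

definition smooth_map :: "('a::real_normed_vector \<Rightarrow> 'b::euclidean_space) \<Rightarrow> bool" where
  "smooth_map f \<longleftrightarrow> (\<forall>b\<in>Basis. smooth (\<lambda>x. f x \<bullet> b))"

lemma smooth_map_compose: "smooth h \<Longrightarrow> smooth_map f \<Longrightarrow> smooth (\<lambda>x. h (f x))"
  by (simp add: smooth_def smooth_map_def Ck_compose)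

lemma smooth_map_bounded_linear: "bounded_linear f \<Longrightarrow> smooth_map f"
  by (simp add: smooth_map_def smooth_bounded_linear bounded_linear_inner_left_comp)

text \<open>With \<open>P = 0\<close> this is Hadamard's lemma; a projection \<open>P\<close> singles out some of the variables.\<close>

lemma Hadamard:
  fixes f :: "'a::euclidean_space \<Rightarrow> real"
  assumes f: "smooth f" and P: "bounded_linear P"
  obtains F where "\<And>b. smooth (F b)"
    "\<And>x. f x = f (P x) + (\<Sum>b\<in>Basis. ((x - P x) \<bullet> b) * F b x)"
proof
  let ?D = "\<lambda>x. frechet_derivative f (at x)"
  let ?Q = "\<lambda>x. x - P x"
  \<comment> \<open>The coefficients are the partial derivatives averaged over the segment from
    \<open>P x\<close> to \<open>x\<close>. The factor \<open>t ^ 0\<close> only brings the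
    integrand into the form treated by \<open>Ck_integral\<close>.\<close>
  let ?F = "\<lambda>b x. integral {0..1::real} (\<lambda>t. t ^ 0 * ?D (P x + t *\<^sub>R ?Q x) b)"
  have Q: "bounded_linear ?Q"
    using P by (simp add: bounded_linear_sub bounded_linear_ident)
  have Ck: "Ck (Suc k) f" for k
    using f by (simp add: smooth_def)
  show "smooth (?F b)" for b
    unfolding smooth_def
  proof
    show "Ck k (?F b)" for k
      using Ck[of k] by (intro Ck_integral[OF P Q]) simp
  qed
  fix x
  let ?y = "\<lambda>t. P x + t *\<^sub>R ?Q x"
  have "((\<lambda>t. f (?y t)) has_vector_derivative ?D (?y t) (?Q x)) (at t within {0..1})" for t
  proof -
    have "(?y has_derivative (\<lambda>s. s *\<^sub>R ?Q x)) (at t within {0..1})"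
      by (auto intro!: derivative_eq_intros)
    from has_derivative_compose[OF this Ck_Suc_derivative[OF Ck]]
    have "((\<lambda>t. f (?y t)) has_derivative (\<lambda>s. ?D (?y t) (s *\<^sub>R ?Q x))) (at t within {0..1})" .
    then show ?thesis
      using linear_scale[OF has_derivative_linear[OF Ck_Suc_derivative[OF Ck]]]
      by (simp add: has_vector_derivative_def)
  qed
  then have I: "((\<lambda>t. ?D (?y t) (?Q x)) has_integral (f (?y 1) - f (?y 0))) {0..1}"
    by (intro fundamental_theorem_of_calculus) auto
  have D: "continuous_on {0..1} (\<lambda>t. ?D (?y t) b)" for b
  proof (rule continuous_on_compose2[of UNIV "\<lambda>x. ?D x b"])
    show "continuous_on UNIV (\<lambda>x. ?D x b)"
      using Ck[of 0] by simp
  qed (auto intro!: continuous_intros)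
  have "?D z (?Q x) = (\<Sum>b\<in>Basis. (?Q x \<bullet> b) * ?D z b)" for z
  proof -
    have "linear (?D z)"
      by (rule has_derivative_linear[OF Ck_Suc_derivative[OF Ck]])
    then have "?D z (\<Sum>b\<in>Basis. (?Q x \<bullet> b) *\<^sub>R b) = (\<Sum>b\<in>Basis. (?Q x \<bullet> b) * ?D z b)"
      by (simp add: linear_sum linear_scale)
    then show ?thesis by (simp add: euclidean_representation)
  qed
  then have "integral {0..1} (\<lambda>t. ?D (?y t) (?Q x)) =
      (\<Sum>b\<in>Basis. (?Q x \<bullet> b) * integral {0..1} (\<lambda>t. ?D (?y t) b))"
    by (simp add: integral_sum integrable_continuous_real D continuous_on_mult_left)
  with integral_unique[OF I]
  show "f x = f (P x) + (\<Sum>b\<in>Basis. (?Q x \<bullet> b) * ?F b x)"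
    by simp
qed

section \<open>Ideals of smooth functions and Weil algebras\<close>

lemma Cinf_simps [simp]:
  "carrier Cinf = {f. smooth f}" "f \<otimes>\<^bsub>Cinf\<^esub> g = (\<lambda>x. f x * g x)" "\<one>\<^bsub>Cinf\<^esub> = (\<lambda>_. 1)"
  "f \<oplus>\<^bsub>Cinf\<^esub> g = (\<lambda>x. f x + g x)" "\<zero>\<^bsub>Cinf\<^esub> = (\<lambda>_. 0)"
  by (simp_all add: Cinf_def)

lemma smooth_minus: "smooth f \<Longrightarrow> smooth (\<lambda>x. - f x)"
  using smooth_diff[OF smooth_const[of 0], of f] by simp

lemma cring_Cinf: "cring Cinf"
proof (rule cringI)
  show "abelian_group Cinf"
    by (rule abelian_groupI) (auto simp: smooth_add fun_eq_iff add_eq_0_iff intro!: exI[of _ "\<lambda>x. - _ x"] smooth_minus)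
  show "Group.comm_monoid Cinf"
    by (rule comm_monoidI) (auto simp: smooth_mult fun_eq_iff)
qed (auto simp: fun_eq_iff algebra_simps)

lemma Cinf_minus:
  assumes "smooth f"
  shows "\<ominus>\<^bsub>Cinf\<^esub> f = (\<lambda>x. - f x)"
proof -
  interpret cring Cinf by (rule cring_Cinf)
  show ?thesis
    using assms by (intro minus_equality) (auto simp: smooth_minus)
qed

text \<open>Closure under negation comes for free, as multiplication by the constant function
  \<open>-1\<close>.\<close>

lemma ideal_CinfI:
  assumes "\<And>f. f \<in> I \<Longrightarrow> smooth f" "(\<lambda>_. 0) \<in> I"
    and "\<And>f g. f \<in> I \<Longrightarrow> g \<in> I \<Longrightarrow> (\<lambda>x. f x + g x) \<in> I"
    and mult: "\<And>f h. f \<in> I \<Longrightarrow> smooth h \<Longrightarrow> (\<lambda>x. h x * f x) \<in> I"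
  shows "ideal I Cinf"
proof (rule idealI)
  show "ring Cinf"
    using cring_Cinf by (rule cring.axioms)
  show "subgroup I (add_monoid Cinf)"
  proof
    show "inv\<^bsub>add_monoid Cinf\<^esub> f \<in> I" if "f \<in> I" for f
      using mult[OF that smooth_const[of "-1"]] assms(1)[OF that]
      unfolding a_inv_def[symmetric] by (simp add: Cinf_minus)
  qed (use assms in auto)
  show "f \<otimes>\<^bsub>Cinf\<^esub> h \<in> I" if "f \<in> I" "h \<in> carrier Cinf" for f h
    using mult[OF that(1), of h] that(2) by (simp add: mult.commute)
qed (use mult in auto)

text \<open>Smoothness puts the equations into the carrier of the ring, so that they generate an
  ideal; vanishing at \<open>0\<close> gives every class a value at \<open>0\<close>, hence every
  point a base point.\<close>

definition weil_eqs :: "('a::euclidean_space \<Rightarrow> real) set \<Rightarrow> bool" where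
  "weil_eqs G \<longleftrightarrow> (\<forall>g\<in>G. smooth g \<and> g 0 = 0)"

lemma weil_ideal_least: "ideal I Cinf \<Longrightarrow> G \<subseteq> I \<Longrightarrow> weil_ideal G \<subseteq> I"
  by (auto simp: weil_ideal_def genideal_def)

context
  fixes G :: "('a::euclidean_space \<Rightarrow> real) set"
  assumes G: "weil_eqs G"
begin

lemma ideal_weil_ideal: "ideal (weil_ideal G) Cinf"
  unfolding weil_ideal_def
  using G by (intro ring.genideal_ideal cring.axioms(1) cring_Cinf) (auto simp: weil_eqs_def)

lemma weil_idealI: "g \<in> G \<Longrightarrow> g \<in> weil_ideal G"
  by (auto simp: weil_ideal_def genideal_def)

lemma weil_ideal_smooth: "f \<in> weil_ideal G \<Longrightarrow> smooth f"
  using ideal.Icarr[OF ideal_weil_ideal] by fastforce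

lemma weil_ideal_zero: "(\<lambda>_. 0) \<in> weil_ideal G"
  using additive_subgroup.zero_closed[OF ideal.axioms(1)[OF ideal_weil_ideal]] by simp

lemma weil_ideal_add: "f \<in> weil_ideal G \<Longrightarrow> g \<in> weil_ideal G \<Longrightarrow> (\<lambda>x. f x + g x) \<in> weil_ideal G"
  using additive_subgroup.a_closed[OF ideal.axioms(1)[OF ideal_weil_ideal]] by simp

lemma weil_ideal_mult: "f \<in> weil_ideal G \<Longrightarrow> smooth h \<Longrightarrow> (\<lambda>x. h x * f x) \<in> weil_ideal G"
  using ideal.I_l_closed[OF ideal_weil_ideal] by simp

lemma weil_ideal_minus: "f \<in> weil_ideal G \<Longrightarrow> (\<lambda>x. - f x) \<in> weil_ideal G"
  using weil_ideal_mult[OF _ smooth_const[of "-1"]] by simp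

lemma weil_ideal_diff: "f \<in> weil_ideal G \<Longrightarrow> g \<in> weil_ideal G \<Longrightarrow> (\<lambda>x. f x - g x) \<in> weil_ideal G"
  using weil_ideal_add[OF _ weil_ideal_minus] by simp

lemma weil_ideal_sum:
  "(\<And>i. i \<in> I \<Longrightarrow> f i \<in> weil_ideal G) \<Longrightarrow> (\<lambda>x. \<Sum>i\<in>I. f i x) \<in> weil_ideal G"
  by (induction I rule: infinite_finite_induct) (auto intro: weil_ideal_add weil_ideal_zero)

text \<open>The smooth functions vanishing at \<open>0\<close> form an ideal that contains the
  equations.\<close>

lemma weil_ideal_at_0: "f \<in> weil_ideal G \<Longrightarrow> f 0 = 0"
proof -
  have "ideal {f :: 'a \<Rightarrow> real. smooth f \<and> f 0 = 0} Cinf"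
    by (rule ideal_CinfI) (auto intro: smooth_add smooth_mult)
  then have "weil_ideal G \<subseteq> {f. smooth f \<and> f 0 = 0}"
    by (rule weil_ideal_least) (use G in \<open>auto simp: weil_eqs_def\<close>)
  then show "f \<in> weil_ideal G \<Longrightarrow> f 0 = 0" by blast
qed

lemma weil_class_altdef: "weil_class G f = {\<lambda>x. h x + f x |h. h \<in> weil_ideal G}"
  by (auto simp: weil_class_def a_r_coset_def')

lemma weil_class_self: "f \<in> weil_class G f"
  unfolding weil_class_altdef using weil_ideal_zero by (auto intro!: exI[of _ "\<lambda>_. 0"])

lemma weil_class_eq_iff: "weil_class G f = weil_class G g \<longleftrightarrow> (\<lambda>x. f x - g x) \<in> weil_ideal G"
proof
  assume "weil_class G f = weil_class G g"
  with weil_class_self obtain h where "h \<in> weil_ideal G" "f = (\<lambda>x. h x + g x)"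
    unfolding weil_class_altdef by blast
  then show "(\<lambda>x. f x - g x) \<in> weil_ideal G"
    by simp
next
  have sub: "weil_class G f \<subseteq> weil_class G g" if d: "(\<lambda>x. f x - g x) \<in> weil_ideal G" for f g
  proof
    fix k assume "k \<in> weil_class G f"
    then obtain h where "h \<in> weil_ideal G" "k = (\<lambda>x. h x + f x)"
      unfolding weil_class_altdef by blast
    then show "k \<in> weil_class G g"
      unfolding weil_class_altdef using weil_ideal_add[OF _ d, of h]
      by (auto intro!: exI[of _ "\<lambda>x. h x + (f x - g x)"])
  qed
  assume "(\<lambda>x. f x - g x) \<in> weil_ideal G"
  with sub[of f g] sub[of g f] weil_ideal_minus[OF this] show "weil_class G f = weil_class G g"
    by auto
qed

lemma weil_class_diff: "g \<in> weil_class G f \<Longrightarrow> (\<lambda>x. g x - f x) \<in> weil_ideal G"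
  unfolding weil_class_altdef by auto

lemma weil_class_at_0: "g \<in> weil_class G f \<Longrightarrow> g 0 = f 0"
  using weil_ideal_at_0[OF weil_class_diff] by simp

end

section \<open>Classes, induced homomorphisms and points of Weil algebras\<close>

lemma carrier_weil: "carrier (weil G) = {weil_class G f |f. smooth f}"
  by (auto simp: weil_def FactRing_def A_RCOSETS_def' weil_class_def)

text \<open>Only the defining equations of the target are tested; that the whole ideal is then
  pulled back into the ideal of the source is \<open>weil_morphism_ideal\<close>.\<close>

definition weil_morphism ::
    "('a::euclidean_space \<Rightarrow> real) set \<Rightarrow> ('a \<Rightarrow> 'b::euclidean_space) \<Rightarrow> ('b \<Rightarrow> real) set \<Rightarrow> bool" where
  "weil_morphism G \<phi> H \<longleftrightarrow>
     weil_eqs G \<and> weil_eqs H \<and> smooth_map \<phi> \<and> (\<forall>h\<in>H. (\<lambda>x. h (\<phi> x)) \<in> weil_ideal G)"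

text \<open>The smooth functions whose composite with \<open>\<phi>\<close> lies in the ideal of
  \<open>G\<close> form an ideal, and it contains \<open>H\<close>.\<close>

lemma weil_morphism_ideal:
  assumes "weil_morphism G \<phi> H" and "f \<in> weil_ideal H"
  shows "(\<lambda>x. f (\<phi> x)) \<in> weil_ideal G"
proof -
  have G: "weil_eqs G" and H: "weil_eqs H" and \<phi>: "smooth_map \<phi>"
    and sub: "\<And>h. h \<in> H \<Longrightarrow> (\<lambda>x. h (\<phi> x)) \<in> weil_ideal G"
    using assms(1) by (auto simp: weil_morphism_def)
  have "ideal {f. smooth f \<and> (\<lambda>x. f (\<phi> x)) \<in> weil_ideal G} Cinf"
    using G \<phi>
    by (intro ideal_CinfI)
      (auto simp: smooth_add smooth_mult weil_ideal_zero weil_ideal_add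
        intro!: weil_ideal_mult smooth_map_compose[OF _ \<phi>])
  then have "weil_ideal H \<subseteq> {f. smooth f \<and> (\<lambda>x. f (\<phi> x)) \<in> weil_ideal G}"
    by (rule weil_ideal_least) (use H sub in \<open>auto simp: weil_eqs_def\<close>)
  then show ?thesis
    using assms(2) by blast
qed

lemma weil_map_class:
  assumes "weil_morphism G \<phi> H"
  shows "weil_map G \<phi> (weil_class H f) = weil_class G (\<lambda>x. f (\<phi> x))"
proof -
  have G: "weil_eqs G" and H: "weil_eqs H"
    using assms by (auto simp: weil_morphism_def)
  have "weil_class G (g \<circ> \<phi>) = weil_class G (\<lambda>x. f (\<phi> x))" if "g \<in> weil_class H f" for g
    using weil_morphism_ideal[OF assms weil_class_diff[OF H that]]
    by (simp add: weil_class_eq_iff[OF G] o_def)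
  then show ?thesis
    using weil_class_self[OF H] by (auto simp: weil_map_def)
qed

definition point_class :: "('a::euclidean_space \<Rightarrow> real) set \<Rightarrow> ('m::finite \<Rightarrow> 'a \<Rightarrow> real) \<Rightarrow> ('a, 'm) weil_point" where
  "point_class G f = (\<chi> i. weil_class G (f i))"

lemma point_class_nth [simp]: "point_class G f $ i = weil_class G (f i)"
  by (simp add: point_class_def)

lemma point_class_eq_iff:
  "weil_eqs G \<Longrightarrow> point_class G f = point_class G g \<longleftrightarrow> (\<forall>i. (\<lambda>x. f i x - g i x) \<in> weil_ideal G)"
  by (simp add: vec_eq_iff weil_class_eq_iff)

lemma point_class_in_weil_points [intro]: "(\<And>i. smooth (f i)) \<Longrightarrow> point_class G f \<in> weil_points G"
  by (auto simp: weil_points_def carrier_weil)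

lemma weil_pointsE:
  assumes "\<gamma> \<in> weil_points G"
  obtains f where "\<And>i. smooth (f i)" "\<gamma> = point_class G f"
proof -
  have "\<forall>i. \<exists>f. smooth f \<and> \<gamma> $ i = weil_class G f"
    using assms by (auto simp: weil_points_def carrier_weil)
  then obtain f where "\<And>i. smooth (f i)" "\<And>i. \<gamma> $ i = weil_class G (f i)"
    by metis
  then show ?thesis
    by (intro that[of f]) (auto simp: vec_eq_iff)
qed

lemma pull_point_class:
  "weil_morphism G \<phi> H \<Longrightarrow> pull G \<phi> (point_class H f) = point_class G (\<lambda>i x. f i (\<phi> x))"
  by (simp add: vec_eq_iff pull_def weil_map_class)

lemma const_point_eq: "const_point G x = point_class G (\<lambda>i _. x $ i)"
  by (simp add: vec_eq_iff const_point_def)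

lemma base_point_class:
  assumes "weil_eqs G"
  shows "base_point (point_class G f) = (\<chi> i. f i 0)"
proof -
  have "(THE r. \<forall>g\<in>weil_class G (f i). g 0 = r) = f i 0" for i
  proof (rule the_equality)
    show "\<forall>g\<in>weil_class G (f i). g 0 = f i 0"
      using weil_class_at_0[OF assms] by blast
    show "r = f i 0" if "\<forall>g\<in>weil_class G (f i). g 0 = r" for r
      using that weil_class_self[OF assms, of "f i"] by auto
  qed
  then show ?thesis
    by (simp add: vec_eq_iff base_point_def)
qed

section \<open>Hadamard decompositions\<close>

lemma sum_Basis_vec:
  "(\<Sum>b\<in>Basis. g (b :: real ^ 'n::finite)) = (\<Sum>i\<in>UNIV. g (axis i 1))"
proof (rule sum.reindex_cong)
  show "inj (\<lambda>i :: 'n. axis i (1::real))"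
    by (simp add: inj_on_def axis_eq_axis)
qed (auto simp: Basis_vec_def)

lemma sum_Basis_prod:
  "(\<Sum>b\<in>Basis. g b) = (\<Sum>b\<in>Basis. g (b, 0)) + (\<Sum>b\<in>Basis. g (0, b))"
  unfolding Basis_prod_def
  by (subst sum.union_disjoint) (auto simp: sum.reindex inj_on_def)

lemma Hadamard_origin:
  fixes f :: "real ^ 'n::finite \<Rightarrow> real"
  assumes "smooth f"
  obtains F where "\<And>i. smooth (F i)" "\<And>x. f x = f 0 + (\<Sum>i\<in>UNIV. x $ i * F i x)"
proof -
  obtain F where F: "\<And>b. smooth (F b)"
    "\<And>x. f x = f 0 + (\<Sum>b\<in>Basis. ((x - 0) \<bullet> b) * F b x)"
    using Hadamard[OF assms bounded_linear_zero] by blast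
  have "f x = f 0 + (\<Sum>i\<in>UNIV. x $ i * F (axis i 1) x)" for x
    by (subst F(2)) (simp add: sum_Basis_vec inner_axis)
  with F(1) show ?thesis
    by (rule that[of "\<lambda>i. F (axis i 1)"])
qed

text \<open>Hadamard's lemma is applied twice: to \<open>f\<close> with the first variable switched
  off, then to each resulting coefficient \<open>F' i\<close> with the second one switched off. The
  part without a factor from \<open>e\<close>, the sum of the terms
  \<open>d $ i * F' i (d, 0)\<close>, equals \<open>f (d, 0) - f 0\<close> by the first expansion at
  \<open>e = 0\<close>. What is left are multiples of the mixed equations of
  \<open>oplus\<close>.\<close>

lemma Hadamard_prod:
  fixes f :: "(real ^ 'p::finite) \<times> (real ^ 'k::finite) \<Rightarrow> real"
  assumes f: "smooth f"
  obtains K where "\<And>i j. smooth (K i j)"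
    "\<And>d e. f (d, e) = f (d, 0) + f (0, e) - f 0 + (\<Sum>i\<in>UNIV. \<Sum>j\<in>UNIV. (d $ i * e $ j) * K i j (d, e))"
proof -
  let ?P1 = "\<lambda>x :: (real ^ 'p) \<times> (real ^ 'k). (0 :: real ^ 'p, snd x)"
  let ?P2 = "\<lambda>x :: (real ^ 'p) \<times> (real ^ 'k). (fst x, 0 :: real ^ 'k)"
  have P: "bounded_linear ?P1" "bounded_linear ?P2"
    by (auto intro!: bounded_linear_Pair bounded_linear_zero bounded_linear_fst bounded_linear_snd)
  obtain F where F: "\<And>b. smooth (F b)"
    "\<And>x. f x = f (?P1 x) + (\<Sum>b\<in>Basis. ((x - ?P1 x) \<bullet> b) * F b x)"
    using Hadamard[OF f P(1)] by blast
  define F' where "F' i = F (axis i 1, 0)" for i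
  have F': "f (d, e) = f (0, e) + (\<Sum>i\<in>UNIV. d $ i * F' i (d, e))" for d e
    by (subst F(2)) (simp add: sum_Basis_prod sum_Basis_vec inner_axis F'_def)
  have "\<exists>K. (\<forall>j. smooth (K j)) \<and>
      (\<forall>d e. F' i (d, e) = F' i (d, 0) + (\<Sum>j\<in>UNIV. e $ j * K j (d, e)))" for i
  proof -
    have "smooth (F' i)"
      by (simp add: F'_def F(1))
    from Hadamard[OF this P(2)] obtain K where K: "\<And>b. smooth (K b)"
      "\<And>x. F' i x = F' i (?P2 x) + (\<Sum>b\<in>Basis. ((x - ?P2 x) \<bullet> b) * K b x)"
      by blast
    have "F' i (d, e) = F' i (d, 0) + (\<Sum>j\<in>UNIV. e $ j * K (0, axis j 1) (d, e))" for d e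
      by (subst K(2)) (simp add: sum_Basis_prod sum_Basis_vec inner_axis)
    then show ?thesis
      using K(1) by (intro exI[of _ "\<lambda>j. K (0, axis j 1)"] conjI allI)
  qed
  then obtain K where K: "\<And>i j. smooth (K i j)"
    "\<And>i d e. F' i (d, e) = F' i (d, 0) + (\<Sum>j\<in>UNIV. e $ j * K i j (d, e))"
    by metis
  show ?thesis
  proof (rule that[of K])
    fix d e
    have "f (d, e) = f (0, e) + (\<Sum>i\<in>UNIV. d $ i * F' i (d, 0)) +
        (\<Sum>i\<in>UNIV. \<Sum>j\<in>UNIV. (d $ i * e $ j) * K i j (d, e))"
      unfolding F'[of d e] K(2)[of _ d e]
      by (simp add: algebra_simps sum.distrib sum_distrib_left)
    then show "f (d, e) = f (d, 0) + f (0, e) - f 0 +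
        (\<Sum>i\<in>UNIV. \<Sum>j\<in>UNIV. (d $ i * e $ j) * K i j (d, e))"
      using F'[of d 0] by (simp add: zero_prod_def)
  qed (rule K(1))
qed

section \<open>Monomials and the ideals of the objects D(p)\<close>

lemma smooth_nth: "smooth (\<lambda>x :: real ^ 'n::finite. x $ i)"
  by (intro smooth_bounded_linear bounded_linear_vec_nth)

lemma monomial_empty [simp]: "monomial {#} = (\<lambda>_. 1)"
  and monomial_add_mset [simp]: "monomial (add_mset i A) = (\<lambda>d. d $ i * monomial A d)"
  and monomial_union: "monomial (A + B) d = monomial A d * monomial B d"
  by (simp_all add: monomial_def fun_eq_iff)

lemma monomial_scaleR: "monomial A (t *\<^sub>R d) = t ^ size A * monomial A d"
  by (induction A) auto

lemma smooth_monomial: "smooth (monomial A)"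
  by (induction A) (auto intro: smooth_mult smooth_nth)

lemma monomial_0: "A \<noteq> {#} \<Longrightarrow> monomial A 0 = 0"
  by (cases A) auto

lemma weil_eqs_D [simp]: "weil_eqs (D_eqs n)"
  by (auto simp: weil_eqs_def D_eqs_def smooth_monomial intro!: monomial_0)

lemma monomial_in_weil_ideal: "Suc n \<le> size A \<Longrightarrow> monomial A \<in> weil_ideal (D_eqs n)"
proof (induction A)
  case (add i A)
  show ?case
  proof (cases "Suc n \<le> size A")
    case True
    then show ?thesis
      using weil_ideal_mult[OF weil_eqs_D add.IH smooth_nth] by simp
  next
    case False
    with add.prems have "size (add_mset i A) = Suc n"
      by simp
    then show ?thesis
      by (intro weil_idealI weil_eqs_D) (auto simp: D_eqs_def simp del: monomial_add_mset size_add_mset)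
  qed
qed simp

lemma finite_multisets_size: "finite {A :: 'p::finite multiset. size A = n}"
proof -
  have "{A :: 'p multiset. size A = n} = multisets_of_size UNIV n"
    by (auto simp: multisets_of_size_def)
  then show ?thesis
    using finite_multisets_of_size[OF finite, of UNIV n] by simp
qed

text \<open>These sums form an ideal containing the equations, so they exhaust the generated one.
  Membership thereby becomes a formula that can be restricted to a ray or expanded at the
  origin.\<close>

lemma weil_ideal_D_representation:
  assumes "f \<in> weil_ideal (D_eqs n :: (real ^ 'p::finite \<Rightarrow> real) set)"
  obtains h where "\<And>A. smooth (h A)"
    "f = (\<lambda>x. \<Sum>A | size A = Suc n. h A x * monomial A x)"
proof -
  let ?r = "\<lambda>h x. \<Sum>A | size (A :: 'p multiset) = Suc n. h A x * monomial A x"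
  let ?I = "{?r h |h. \<forall>A. smooth (h A)}"
  have "ideal ?I Cinf"
  proof (rule ideal_CinfI)
    show "smooth f" if "f \<in> ?I" for f
      using that by (auto intro!: smooth_sum smooth_mult smooth_monomial)
    show "(\<lambda>_. 0) \<in> ?I"
      by (auto intro!: exI[of _ "\<lambda>_ _. 0"])
    show "(\<lambda>x. f x + g x) \<in> ?I" if "f \<in> ?I" "g \<in> ?I" for f g
    proof -
      from that obtain h k where "\<forall>A. smooth (h A)" "f = ?r h" "\<forall>A. smooth (k A)" "g = ?r k"
        by blast
      then show ?thesis
        by (auto simp: smooth_add fun_eq_iff algebra_simps sum.distrib
            intro!: exI[of _ "\<lambda>A x. h A x + k A x"])
    qed
    show "(\<lambda>x. k x * f x) \<in> ?I" if "f \<in> ?I" "smooth k" for f k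
    proof -
      from that obtain h where "\<forall>A. smooth (h A)" "f = ?r h"
        by blast
      then show ?thesis
        using that(2) by (auto simp: smooth_mult fun_eq_iff algebra_simps sum_distrib_left
            intro!: exI[of _ "\<lambda>A x. k x * h A x"])
    qed
  qed
  moreover have "D_eqs n \<subseteq> ?I"
  proof
    fix g :: "real ^ 'p \<Rightarrow> real"
    assume "g \<in> D_eqs n"
    then obtain A where A: "g = monomial A" "size A = Suc n"
      by (auto simp: D_eqs_def)
    then have "g = ?r (\<lambda>B _. if B = A then 1 else 0)"
      using A by (simp add: fun_eq_iff if_distrib[of "\<lambda>z. z * _"] finite_multisets_size sum.delta cong: if_cong)
    moreover have "\<forall>B. smooth (\<lambda>_ :: real ^ 'p. if B = A then 1 else 0)"
      by simp
    ultimately show "g \<in> ?I"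
      unfolding mem_Collect_eq by (intro exI[of _ "\<lambda>B _. if B = A then 1 else 0"] conjI)
  qed
  ultimately have "weil_ideal (D_eqs n) \<subseteq> ?I"
    by (rule weil_ideal_least)
  with assms that show thesis
    by blast
qed

text \<open>Substituting distinct primes for the coordinates separates the values of the monomials, and
  raising these to powers leaves a Vandermonde system for the coefficients.\<close>

lemma monomials_independent:
  assumes S: "finite S" and zero: "\<And>d. (\<Sum>A\<in>S. c A * monomial A (d :: real ^ 'p::finite)) = 0"
    and B: "B \<in> S"
  shows "c B = 0"
proof -
  have "\<exists>q :: 'p \<Rightarrow> nat. inj q \<and> range q \<subseteq> {p. prime p}"
  proof -
    obtain f :: "nat \<Rightarrow> nat" where f: "inj f" "range f \<subseteq> {p. prime p}"
      using infinite_countable_subset[OF primes_infinite] by blast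
    obtain e :: "'p \<Rightarrow> nat" where "inj e"
      using finite_imp_inj_to_nat_seg[of "UNIV :: 'p set"] by auto
    then have "inj (f \<circ> e)" "range (f \<circ> e) \<subseteq> {p. prime p}"
      using f by (auto intro: inj_compose)
    then show ?thesis
      by blast
  qed
  then obtain q :: "'p \<Rightarrow> nat" where q: "inj q" "\<And>i. prime (q i)"
    by (auto simp: image_subset_iff)
  define v where "v A = real (\<Prod>i\<in>#A. q i)" for A
  have v_inj: "v A = v A' \<longleftrightarrow> A = A'" for A A'
  proof
    assume "v A = v A'"
    then have "prod_mset (image_mset q A) = prod_mset (image_mset q A')"
      unfolding v_def by (simp only: of_nat_eq_iff)
    then have "prime_factorization (prod_mset (image_mset q A)) =
        prime_factorization (prod_mset (image_mset q A'))"
      by simp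
    then have "image_mset q A = image_mset q A'"
      using q(2) by (subst (asm) (1 2) prime_factorization_prod_mset_primes) auto
    then show "A = A'"
      using injD[OF multiset.inj_map[OF q(1)]] by blast
  qed simp
  have powers: "(\<Sum>A\<in>S. c A * v A ^ r) = 0" for r
  proof -
    have "monomial A (\<chi> i. real (q i) ^ r) = v A ^ r" for A
      by (induction A) (auto simp: v_def power_mult_distrib)
    then show ?thesis
      using zero[of "\<chi> i. real (q i) ^ r"] by simp
  qed
  have poly: "(\<Sum>A\<in>S. c A * poly P (v A)) = 0" for P
  proof -
    have "(\<Sum>A\<in>S. c A * poly P (v A)) = (\<Sum>A\<in>S. \<Sum>r\<le>degree P. coeff P r * (c A * v A ^ r))"
      by (simp add: poly_altdef sum_distrib_left algebra_simps)
    also have "\<dots> = (\<Sum>r\<le>degree P. coeff P r * (\<Sum>A\<in>S. c A * v A ^ r))"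
      by (subst sum.swap) (simp add: sum_distrib_left)
    finally show ?thesis
      by (simp add: powers)
  qed
  \<comment> \<open>An unnormalised Lagrange polynomial for the node \<open>v B\<close>: it removes
    every other term from the sum, which takes the place of inverting the Vandermonde
    matrix.\<close>
  let ?P = "\<Prod>A\<in>S - {B}. [:- v A, 1:]"
  have "c A * poly ?P (v A) = 0" if "A \<in> S - {B}" for A
    using S that by (auto simp: poly_prod)
  then have "(\<Sum>A\<in>S - {B}. c A * poly ?P (v A)) = 0"
    by (rule sum.neutral[rule_format])
  then have "c B * poly ?P (v B) = 0"
    using poly[of ?P] sum.remove[OF S B, of "\<lambda>A. c A * poly ?P (v A)"] by linarith
  moreover have "poly ?P (v B) \<noteq> 0"
    using S v_inj by (auto simp: poly_prod)
  ultimately show ?thesis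
    by simp
qed

text \<open>Along a ray, a member of the ideal vanishes to order \<open>n + 2\<close> at the origin, a homogeneous
  polynomial of degree \<open>n + 1\<close> only to order \<open>n + 1\<close>.\<close>

lemma homogeneous_in_weil_ideal:
  assumes mem: "(\<lambda>d. \<Sum>A\<in>S. c A * monomial A d) \<in> weil_ideal (D_eqs (Suc n))"
    and S: "S \<subseteq> {A. size A = Suc n}" and B: "B \<in> S"
  shows "c B = 0"
proof (rule monomials_independent[OF _ _ B])
  show "finite S"
    using S finite_multisets_size by (rule finite_subset)
  fix d
  obtain h where h: "\<And>A. smooth (h A)"
    "(\<lambda>d. \<Sum>A\<in>S. c A * monomial A d) = (\<lambda>x. \<Sum>A | size A = Suc (Suc n). h A x * monomial A x)"
    using weil_ideal_D_representation[OF mem] by blast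
  let ?s = "\<Sum>A\<in>S. c A * monomial A d"
  \<comment> \<open>A monomial of degree \<open>n + 2\<close> at \<open>t *\<^sub>R d\<close>
    contributes \<open>t ^ (n + 2)\<close>; one factor \<open>t\<close> survives division by
    \<open>t ^ (n + 1)\<close>, and it makes \<open>?k 0\<close> vanish.\<close>
  let ?k = "\<lambda>t. t * (\<Sum>A | size A = Suc (Suc n). h A (t *\<^sub>R d) * monomial A d)"
  have "?s = ?k t" if "t \<noteq> 0" for t
  proof -
    have "(\<Sum>A\<in>S. c A * monomial A (t *\<^sub>R d)) = t ^ Suc n * ?s"
      using S by (auto simp: monomial_scaleR sum_distrib_left intro!: sum.cong)
    moreover have "(\<Sum>A | size A = Suc (Suc n). h A (t *\<^sub>R d) * monomial A (t *\<^sub>R d)) = t ^ Suc n * ?k t"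
      by (auto simp: monomial_scaleR sum_distrib_left intro!: sum.cong)
    ultimately have "t ^ Suc n * ?s = t ^ Suc n * ?k t"
      using fun_cong[OF h(2), of "t *\<^sub>R d"] by (simp only:)
    moreover have "t ^ Suc n \<noteq> 0"
      using that by simp
    ultimately show ?thesis
      unfolding mult_cancel_left by blast
  qed
  \<comment> \<open>The division is possible only for \<open>t \<noteq> 0\<close>, so the value at
    \<open>0\<close> is reached as a limit: the constant \<open>?s\<close> is the limit of the
    continuous function \<open>?k\<close>.\<close>
  then have "\<forall>\<^sub>F t in at 0. ?k t = ?s"
    by (auto simp: eventually_at_filter)
  then have "(?k \<longlongrightarrow> ?s) (at 0)"
    by (rule tendsto_eventually)
  moreover have "continuous_on UNIV ?k"
  proof (intro continuous_intros)
    show "continuous_on UNIV (\<lambda>t. h A (t *\<^sub>R d))" for A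
      by (rule continuous_on_compose2[OF smooth_imp_continuous_on[OF h(1)]])
        (auto intro!: continuous_intros)
  qed
  then have "(?k \<longlongrightarrow> ?k 0) (at 0)"
    unfolding continuous_on_def by blast
  ultimately have "?s = ?k 0"
    using tendsto_unique[OF trivial_limit_at] by blast
  then show "?s = 0"
    by simp
qed

section \<open>Morphisms of infinitesimal objects\<close>

lemma smooth_map_vec: "(\<And>k. smooth (\<lambda>x. f x $ k)) \<Longrightarrow> smooth_map (f :: _ \<Rightarrow> real ^ 'k::finite)"
  by (auto simp: smooth_map_def Basis_vec_def inner_axis)

lemma smooth_map_Pair: "smooth_map f \<Longrightarrow> smooth_map g \<Longrightarrow> smooth_map (\<lambda>x. (f x, g x))"
  by (auto simp: smooth_map_def Basis_prod_def)

lemma ball_oplus: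
  "(\<forall>f\<in>oplus G H. P f) \<longleftrightarrow>
    (\<forall>g\<in>G. P (\<lambda>z. g (fst z))) \<and> (\<forall>h\<in>H. P (\<lambda>z. h (snd z))) \<and>
    (\<forall>i j. P (\<lambda>z. fst z $ i * snd z $ j))"
  by (auto simp: oplus_def o_def case_prod_beta')

lemma ball_D_eqs: "(\<forall>f\<in>D_eqs n. P f) \<longleftrightarrow> (\<forall>A. size A = Suc n \<longrightarrow> P (monomial A))"
  by (auto simp: D_eqs_def)

lemma weil_eqs_oplus [simp]:
  fixes G :: "(real ^ 'p::finite \<Rightarrow> real) set" and H :: "(real ^ 'k::finite \<Rightarrow> real) set"
  assumes "weil_eqs G" "weil_eqs H"
  shows "weil_eqs (oplus G H)"
proof -
  have "smooth (\<lambda>x :: (real ^ 'p) \<times> (real ^ 'k). g (fst x))" if "g \<in> G" for g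
    using that assms(1) by (auto simp: weil_eqs_def smooth_map_compose[OF _ smooth_map_bounded_linear[OF bounded_linear_fst]])
  moreover have "smooth (\<lambda>x :: (real ^ 'p) \<times> (real ^ 'k). h (snd x))" if "h \<in> H" for h
    using that assms(2) by (auto simp: weil_eqs_def smooth_map_compose[OF _ smooth_map_bounded_linear[OF bounded_linear_snd]])
  moreover have "smooth (\<lambda>x :: (real ^ 'p) \<times> (real ^ 'k). fst x $ i * snd x $ j)" for i j
    by (intro smooth_mult smooth_map_compose[OF smooth_nth] smooth_map_bounded_linear
        bounded_linear_fst bounded_linear_snd)
  ultimately show ?thesis
    using assms by (simp add: weil_eqs_def ball_oplus)
qed

lemma oplus_ideal:
  assumes "weil_eqs G" "weil_eqs H"
  shows "g \<in> G \<Longrightarrow> (\<lambda>z. g (fst z)) \<in> weil_ideal (oplus G H)"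
    and "h \<in> H \<Longrightarrow> (\<lambda>z. h (snd z)) \<in> weil_ideal (oplus G H)"
    and "(\<lambda>z. fst z $ i * snd z $ j) \<in> weil_ideal (oplus G H)"
proof -
  have "\<forall>f\<in>oplus G H. f \<in> weil_ideal (oplus G H)"
    using weil_idealI[OF weil_eqs_oplus[OF assms]] by blast
  then show "g \<in> G \<Longrightarrow> (\<lambda>z. g (fst z)) \<in> weil_ideal (oplus G H)"
    and "h \<in> H \<Longrightarrow> (\<lambda>z. h (snd z)) \<in> weil_ideal (oplus G H)"
    and "(\<lambda>z. fst z $ i * snd z $ j) \<in> weil_ideal (oplus G H)"
    unfolding ball_oplus by blast+
qed

lemma smooth_map_inj2: "smooth_map inj2"
  unfolding inj2_def[abs_def]
  by (simp add: smooth_map_bounded_linear bounded_linear_Pair bounded_linear_ident bounded_linear_zero)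

lemma weil_morphism_id: "weil_eqs G \<Longrightarrow> weil_morphism G (\<lambda>d. d) G"
  by (simp add: weil_morphism_def smooth_map_bounded_linear bounded_linear_ident weil_idealI)

lemma weil_morphism_0: "weil_eqs G \<Longrightarrow> weil_eqs H \<Longrightarrow> weil_morphism G (\<lambda>_. 0) H"
  by (auto simp: weil_morphism_def smooth_map_bounded_linear bounded_linear_zero weil_eqs_def
      weil_ideal_zero)

lemma weil_morphism_fst: "weil_eqs G \<Longrightarrow> weil_eqs H \<Longrightarrow> weil_morphism (oplus G H) fst G"
  by (simp add: weil_morphism_def smooth_map_bounded_linear bounded_linear_fst oplus_ideal)

lemma weil_morphism_snd: "weil_eqs G \<Longrightarrow> weil_eqs H \<Longrightarrow> weil_morphism (oplus G H) snd H"
  by (simp add: weil_morphism_def smooth_map_bounded_linear bounded_linear_snd oplus_ideal)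

lemma weil_morphism_Pair:
  assumes f: "weil_morphism K f G" and g: "weil_morphism K g H"
    and fg: "\<And>i j. (\<lambda>x. f x $ i * g x $ j) \<in> weil_ideal K"
  shows "weil_morphism K (\<lambda>x. (f x, g x)) (oplus G H)"
  using assms by (simp add: weil_morphism_def smooth_map_Pair ball_oplus)

lemma weil_morphism_inj1: "weil_eqs G \<Longrightarrow> weil_eqs H \<Longrightarrow> weil_morphism G inj1 (oplus G H)"
  unfolding inj1_def
  by (intro weil_morphism_Pair weil_morphism_id weil_morphism_0) (simp_all add: weil_ideal_zero)

lemma weil_morphism_inj2: "weil_eqs G \<Longrightarrow> weil_eqs H \<Longrightarrow> weil_morphism H inj2 (oplus G H)"
  unfolding inj2_def
  by (intro weil_morphism_Pair weil_morphism_id weil_morphism_0) (simp_all add: weil_ideal_zero)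

lemma weil_morphism_restrict: "weil_morphism (D_eqs n) (\<lambda>d. d) (D_eqs (Suc n))"
  unfolding weil_morphism_def
  by (simp add: smooth_map_bounded_linear bounded_linear_ident ball_D_eqs monomial_in_weil_ideal)

lemma weil_morphism_scaleR: "weil_morphism (D_eqs n) (\<lambda>d. a *\<^sub>R d) (D_eqs n)"
  unfolding weil_morphism_def
proof (intro conjI ballI)
  show "smooth_map (\<lambda>d :: real ^ 'b. a *\<^sub>R d)"
    by (intro smooth_map_bounded_linear bounded_linear_scaleR_right)
  fix h :: "real ^ 'b \<Rightarrow> real"
  assume "h \<in> D_eqs n"
  then obtain A where A: "h = monomial A" "size A = Suc n"
    by (auto simp: D_eqs_def)
  then have "monomial A \<in> weil_ideal (D_eqs n)"
    by (intro monomial_in_weil_ideal) simp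
  from weil_ideal_mult[OF weil_eqs_D this smooth_const[of "a ^ size A"]]
  show "(\<lambda>d. h (a *\<^sub>R d)) \<in> weil_ideal (D_eqs n)"
    by (simp only: A monomial_scaleR)
qed simp_all

lemma D1_cases:
  assumes "h \<in> D_eqs 1"
  obtains k l where "h = (\<lambda>e. e $ k * e $ l)"
proof -
  obtain A where A: "h = monomial A" "size A = Suc 1"
    using assms by (auto simp: D_eqs_def)
  then obtain k B where "A = add_mset k B"
    using size_eq_Suc_imp_eq_union by blast
  moreover from this A have "size B = Suc 0"
    by simp
  ultimately obtain l where "A = {#k, l#}"
    using size_1_singleton_mset[of B] by auto
  with A that[of k l] show thesis
    by simp
qed

lemma quadratic_in_weil_ideal: "(\<lambda>e. e $ k * e $ l) \<in> weil_ideal (D_eqs 1)"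
  using monomial_in_weil_ideal[of 1 "{#k, l#}"] by simp

text \<open>The second component of \<open>Psi\<close>, kept separate because it is itself a
  morphism into the first-order object, along which symbols are pulled back.\<close>

definition monomials :: "('k::finite \<Rightarrow> 'p::finite multiset) \<Rightarrow> real ^ 'p \<Rightarrow> real ^ 'k" where
  "monomials \<iota> d = (\<chi> k. monomial (\<iota> k) d)"

lemma monomials_nth [simp]: "monomials \<iota> d $ k = monomial (\<iota> k) d"
  by (simp add: monomials_def)

text \<open>A product of two monomials of degree \<open>n + 1\<close> has degree
  \<open>2 * n + 2\<close>, which is at least \<open>n + 2\<close> even for
  \<open>n = 0\<close>.\<close>

lemma weil_morphism_monomials:
  assumes "\<And>k. size (\<iota> k) = Suc n"
  shows "weil_morphism (D_eqs (Suc n)) (monomials \<iota>) (D_eqs 1)"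
  unfolding weil_morphism_def
proof (intro conjI ballI)
  show "smooth_map (monomials \<iota>)"
    by (intro smooth_map_vec) (simp add: smooth_monomial)
  fix h :: "real ^ 'a \<Rightarrow> real"
  assume "h \<in> D_eqs 1"
  then obtain k l where h: "h = (\<lambda>e. e $ k * e $ l)"
    by (rule D1_cases)
  have "monomial (\<iota> k + \<iota> l) \<in> weil_ideal (D_eqs (Suc n))"
    using assms[of k] assms[of l] by (intro monomial_in_weil_ideal) simp
  then show "(\<lambda>d. h (monomials \<iota> d)) \<in> weil_ideal (D_eqs (Suc n))"
    by (simp add: h monomial_union[abs_def])
qed simp_all

text \<open>The mixed equations pull back to a coordinate times a monomial of degree
  \<open>n + 1\<close>, which is a monomial of degree \<open>n + 2\<close>.\<close>

lemma weil_morphism_Psi: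
  assumes "\<And>k. size (\<iota> k) = Suc n"
  shows "weil_morphism (D_eqs (Suc n)) (Psi \<iota>) (oplus (D_eqs (Suc n)) (D_eqs 1))"
proof -
  have "monomial (add_mset i (\<iota> k)) \<in> weil_ideal (D_eqs (Suc n))" for i k
    using assms[of k] by (intro monomial_in_weil_ideal) simp
  then have "weil_morphism (D_eqs (Suc n)) (\<lambda>d. (d, monomials \<iota> d)) (oplus (D_eqs (Suc n)) (D_eqs 1))"
    using assms by (intro weil_morphism_Pair weil_morphism_id weil_morphism_monomials) simp_all
  then show ?thesis
    by (simp add: Psi_def[abs_def] monomials_def)
qed

lemma weil_morphism_diagonal: "weil_morphism (D_eqs 1) (\<lambda>d. (d, d)) (oplus (D_eqs 1) (D_eqs 1))"
  by (intro weil_morphism_Pair weil_morphism_id quadratic_in_weil_ideal weil_eqs_D)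

section \<open>Normal forms and membership criteria for the ideals\<close>

lemma linear_modulo_D1:
  assumes h: "smooth (h :: real ^ 'k::finite \<Rightarrow> real)"
  obtains c where "(\<lambda>e. h e - h 0 - (\<Sum>k\<in>UNIV. c k * e $ k)) \<in> weil_ideal (D_eqs 1)"
proof -
  obtain F where F: "\<And>k. smooth (F k)" "\<And>e. h e = h 0 + (\<Sum>k\<in>UNIV. e $ k * F k e)"
    using Hadamard_origin[OF h] by blast
  \<comment> \<open>Expanding each first-order coefficient once more leaves a remainder made of
    products of two coordinates, which are the equations; the linear coefficients are the values
    \<open>F k 0\<close>.\<close>
  have "\<exists>K. (\<forall>l. smooth (K l)) \<and> (\<forall>e. F k e = F k 0 + (\<Sum>l\<in>UNIV. e $ l * K l e))" for k
  proof -
    obtain K where "\<And>l. smooth (K l)" "\<And>e. F k e = F k 0 + (\<Sum>l\<in>UNIV. e $ l * K l e)"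
      using Hadamard_origin[OF F(1)[of k]] by blast
    then show ?thesis
      by (intro exI[of _ K] conjI allI)
  qed
  then obtain K where K: "\<And>k l. smooth (K k l)"
    "\<And>k e. F k e = F k 0 + (\<Sum>l\<in>UNIV. e $ l * K k l e)"
    by metis
  have "h e - h 0 - (\<Sum>k\<in>UNIV. F k 0 * e $ k) = (\<Sum>k\<in>UNIV. \<Sum>l\<in>UNIV. K k l e * (e $ k * e $ l))" for e
  proof -
    have "h e - h 0 - (\<Sum>k\<in>UNIV. F k 0 * e $ k) = (\<Sum>k\<in>UNIV. e $ k * (F k e - F k 0))"
      using F(2)[of e] by (simp add: algebra_simps sum_subtractf)
    also have "\<dots> = (\<Sum>k\<in>UNIV. e $ k * (\<Sum>l\<in>UNIV. e $ l * K k l e))"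
      using K(2)[of _ e] by (intro sum.cong refl) (metis add_diff_cancel_left')
    finally show ?thesis
      by (simp add: sum_distrib_left algebra_simps)
  qed
  moreover have "(\<lambda>e. \<Sum>k\<in>UNIV. \<Sum>l\<in>UNIV. K k l e * (e $ k * e $ l)) \<in> weil_ideal (D_eqs 1)"
    by (intro weil_ideal_sum weil_ideal_mult[OF weil_eqs_D quadratic_in_weil_ideal] weil_eqs_D K(1))
  ultimately show thesis
    by (intro that[of "\<lambda>k. F k 0"]) (simp only:)
qed

text \<open>This is the uniqueness behind \<open>glue\<close>. By \<open>Hadamard_prod\<close>,
  \<open>f\<close> is the sum of its two restrictions, pulled back along the projections, and of
  multiples of the mixed equations; the constant term \<open>f 0\<close> is zero because
  \<open>f\<close> restricts into an ideal.\<close>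

lemma oplus_ideal_memI:
  fixes f :: "(real ^ 'p::finite) \<times> (real ^ 'k::finite) \<Rightarrow> real"
  assumes G: "weil_eqs G" and H: "weil_eqs H" and f: "smooth f"
    and f1: "(\<lambda>d. f (inj1 d)) \<in> weil_ideal G" and f2: "(\<lambda>e. f (inj2 e)) \<in> weil_ideal H"
  shows "f \<in> weil_ideal (oplus G H)"
proof -
  let ?I = "weil_ideal (oplus G H)"
  note GH = weil_eqs_oplus[OF G H]
  obtain K where K: "\<And>i j. smooth (K i j)"
    "\<And>d e. f (d, e) = f (d, 0) + f (0, e) - f 0 + (\<Sum>i\<in>UNIV. \<Sum>j\<in>UNIV. (d $ i * e $ j) * K i j (d, e))"
    using Hadamard_prod[OF f] by blast
  have "f 0 = 0"
    using weil_ideal_at_0[OF G f1] by (simp add: inj1_def zero_prod_def)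
  have "f = (\<lambda>z. f (inj1 (fst z)) + f (inj2 (snd z)) +
      (\<Sum>i\<in>UNIV. \<Sum>j\<in>UNIV. K i j z * (fst z $ i * snd z $ j)))"
  proof
    fix z
    show "f z = f (inj1 (fst z)) + f (inj2 (snd z)) +
        (\<Sum>i\<in>UNIV. \<Sum>j\<in>UNIV. K i j z * (fst z $ i * snd z $ j))"
      using K(2)[of "fst z" "snd z"] \<open>f 0 = 0\<close> by (simp add: inj1_def inj2_def mult.commute)
  qed
  moreover have "(\<lambda>z. f (inj1 (fst z)) + f (inj2 (snd z)) +
      (\<Sum>i\<in>UNIV. \<Sum>j\<in>UNIV. K i j z * (fst z $ i * snd z $ j))) \<in> ?I"
    by (intro weil_ideal_add[OF GH] weil_ideal_sum[OF GH] weil_ideal_mult[OF GH oplus_ideal(3)[OF G H]] K(1)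
        weil_morphism_ideal[OF weil_morphism_fst[OF G H] f1]
        weil_morphism_ideal[OF weil_morphism_snd[OF G H] f2])
  \<comment> \<open>A single directed substitution, since \<open>f\<close> occurs again on the
    right-hand side of its own equation.\<close>
  ultimately show ?thesis
    by (rule ssubst[of f _ "\<lambda>g. g \<in> ?I"])
qed

text \<open>This is the uniqueness behind \<open>jet_diff\<close>. The restriction along
  \<open>inj2\<close> is linear modulo squares; pulled back along \<open>Psi\<close>, that linear
  part turns into a combination of monomials of degree \<open>n + 1\<close> lying in the ideal, so
  its coefficients vanish.\<close>

lemma Psi_ideal_memI:
  fixes f :: "(real ^ 'p::finite) \<times> (real ^ 'k::finite) \<Rightarrow> real"
  assumes \<iota>: "monomial_enum n \<iota>" and f: "smooth f"
    and f1: "(\<lambda>d. f (inj1 d)) \<in> weil_ideal (D_eqs (Suc n))"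
    and fPsi: "(\<lambda>d. f (Psi \<iota> d)) \<in> weil_ideal (D_eqs (Suc n))"
  shows "f \<in> weil_ideal (oplus (D_eqs (Suc n)) (D_eqs 1))"
proof (rule oplus_ideal_memI[OF weil_eqs_D weil_eqs_D f f1])
  let ?I = "weil_ideal (D_eqs (Suc n))" and ?O = "oplus (D_eqs (Suc n)) (D_eqs 1)"
  have size: "size (\<iota> k) = Suc n" for k
    using \<iota> by (auto simp: monomial_enum_def bij_betw_def)
  have inj: "inj \<iota>"
    using \<iota> by (auto simp: monomial_enum_def bij_betw_def)
  have f2: "smooth (\<lambda>e. f (inj2 e))"
    by (rule smooth_map_compose[OF f smooth_map_inj2])
  have f0: "f 0 = 0"
    using weil_ideal_at_0[OF weil_eqs_D f1] by (simp add: inj1_def zero_prod_def)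
  obtain c where c: "(\<lambda>e. f (inj2 e) - f (inj2 0) - (\<Sum>k\<in>UNIV. c k * e $ k)) \<in> weil_ideal (D_eqs 1)"
    using linear_modulo_D1[OF f2] by blast
  then have c: "(\<lambda>e. f (inj2 e) - (\<Sum>k\<in>UNIV. c k * e $ k)) \<in> weil_ideal (D_eqs 1)"
    by (simp add: inj2_def f0 flip: zero_prod_def)
  \<comment> \<open>\<open>r\<close> compares \<open>f\<close> with the function rebuilt from its
    restriction to the first summand and its linear part on the second. It lies in the ideal by
    \<open>oplus_ideal_memI\<close>, and its pullback along \<open>Psi\<close> is where the
    monomials appear.\<close>
  define r where "r z = f z - f (inj1 (fst z)) - (\<Sum>k\<in>UNIV. c k * snd z $ k)" for z
  have "r \<in> weil_ideal ?O"
  proof (rule oplus_ideal_memI)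
    show "smooth r"
      unfolding r_def
      by (intro smooth_diff smooth_sum smooth_mult smooth_const f smooth_map_compose[OF f]
          smooth_map_compose[OF weil_ideal_smooth[OF weil_eqs_D f1]] smooth_map_compose[OF smooth_nth]
          smooth_map_bounded_linear bounded_linear_fst bounded_linear_snd)
    show "(\<lambda>d. r (inj1 d)) \<in> ?I"
      by (simp add: r_def inj1_def weil_ideal_zero)
    show "(\<lambda>e. r (inj2 e)) \<in> weil_ideal (D_eqs 1)"
      using c f0 by (simp add: r_def inj1_def inj2_def flip: zero_prod_def)
  qed simp_all
  from weil_morphism_ideal[OF weil_morphism_Psi[OF size] this]
  have "(\<lambda>d. f (Psi \<iota> d) - f (inj1 d) - (\<Sum>k\<in>UNIV. c k * monomial (\<iota> k) d)) \<in> ?I"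
    by (simp add: r_def Psi_def)
  from weil_ideal_diff[OF weil_eqs_D weil_ideal_diff[OF weil_eqs_D fPsi f1] this]
  have "(\<lambda>d. \<Sum>k\<in>UNIV. c k * monomial (\<iota> k) d) \<in> ?I"
    by simp
  \<comment> \<open>Independence is stated for coefficients indexed by multisets, so the sum is
    carried over along the injective enumeration.\<close>
  moreover have "(\<Sum>k\<in>UNIV. c k * monomial (\<iota> k) d) = (\<Sum>A\<in>range \<iota>. c (inv_into UNIV \<iota> A) * monomial A d)" for d
    by (simp add: sum.reindex[OF inj] inv_f_f[OF inj])
  ultimately have "(\<lambda>d. \<Sum>A\<in>range \<iota>. c (inv_into UNIV \<iota> A) * monomial A d) \<in> ?I"
    by simp
  then have "c (inv_into UNIV \<iota> (\<iota> k)) = 0" for k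
    by (rule homogeneous_in_weil_ideal) (auto simp: size)
  then have "c k = 0" for k
    by (simp add: inv_f_f[OF inj])
  with c show "(\<lambda>e. f (inj2 e)) \<in> weil_ideal (D_eqs 1)"
    by simp
qed

text \<open>Smooth coefficients of the monomials of degree \<open>n + 1\<close> may be frozen at the
  origin: by Hadamard's lemma the error gains a coordinate as a factor, and with it the degree
  \<open>n + 2\<close>.\<close>

lemma leading_coefficients:
  assumes \<iota>: "monomial_enum n (\<iota> :: 'k::finite \<Rightarrow> 'p::finite multiset)"
    and f: "f \<in> weil_ideal (D_eqs n)"
  obtains c where "(\<lambda>d. f d - (\<Sum>k\<in>UNIV. c k * monomial (\<iota> k) d)) \<in> weil_ideal (D_eqs (Suc n))"
proof -
  have bij: "bij_betw \<iota> UNIV {A. size A = Suc n}"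
    using \<iota> by (simp add: monomial_enum_def)
  have size: "size (\<iota> k) = Suc n" for k
    using bij by (auto simp: bij_betw_def)
  obtain h where h: "\<And>A. smooth (h A)" "f = (\<lambda>x. \<Sum>A | size A = Suc n. h A x * monomial A x)"
    using weil_ideal_D_representation[OF f] by blast
  have f_eq: "f x = (\<Sum>k\<in>UNIV. h (\<iota> k) x * monomial (\<iota> k) x)" for x
    unfolding h(2) by (rule sum.reindex_bij_betw[OF bij, symmetric])
  have "(\<lambda>x. (h (\<iota> k) x - h (\<iota> k) 0) * monomial (\<iota> k) x) \<in> weil_ideal (D_eqs (Suc n))" for k
  proof -
    obtain F where F: "\<And>i. smooth (F i)"
      "\<And>x. h (\<iota> k) x = h (\<iota> k) 0 + (\<Sum>i\<in>UNIV. x $ i * F i x)"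
      using Hadamard_origin[OF h(1)[of "\<iota> k"]] by blast
    have "(h (\<iota> k) x - h (\<iota> k) 0) * monomial (\<iota> k) x =
        (\<Sum>i\<in>UNIV. F i x * monomial (add_mset i (\<iota> k)) x)" for x
      using F(2)[of x] by (simp add: sum_distrib_right algebra_simps sum_distrib_left)
    moreover have "monomial (add_mset i (\<iota> k)) \<in> weil_ideal (D_eqs (Suc n))" for i
      using size[of k] by (intro monomial_in_weil_ideal) simp
    ultimately show ?thesis
      using F(1) by (simp only:) (intro weil_ideal_sum weil_ideal_mult weil_eqs_D)
  qed
  then have "(\<lambda>x. \<Sum>k\<in>UNIV. (h (\<iota> k) x - h (\<iota> k) 0) * monomial (\<iota> k) x) \<in> weil_ideal (D_eqs (Suc n))"
    by (intro weil_ideal_sum weil_eqs_D)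
  then show thesis
    by (intro that[of "\<lambda>k. h (\<iota> k) 0"]) (simp add: f_eq left_diff_distrib sum_subtractf)
qed

section \<open>Gluing and the operations on jets\<close>

text \<open>Rules stated for \<open>D_eqs 1\<close> would no longer match after \<open>1\<close> is
  rewritten to \<open>Suc 0\<close>.\<close>

declare One_nat_def [simp del]

lemma smooth_fst_snd:
  fixes g :: "'a::euclidean_space \<Rightarrow> real" and h :: "'b::euclidean_space \<Rightarrow> real"
  assumes "smooth g" "smooth h"
  shows "smooth (\<lambda>z. g (fst z) + h (snd z) - c)"
  by (intro smooth_diff smooth_add smooth_const smooth_map_compose[OF assms(1)] smooth_map_compose[OF assms(2)]
      smooth_map_bounded_linear bounded_linear_fst bounded_linear_snd)

lemma oplus_points_eqI:
  assumes G: "weil_eqs G" and H: "weil_eqs H"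
    and "\<delta> \<in> weil_points (oplus G H)" "\<delta>' \<in> weil_points (oplus G H)"
    and "pull G inj1 \<delta> = pull G inj1 \<delta>'" "pull H inj2 \<delta> = pull H inj2 \<delta>'"
  shows "\<delta> = \<delta>'"
proof -
  obtain f f' where f: "\<And>i. smooth (f i)" "\<And>i. smooth (f' i)"
    "\<delta> = point_class (oplus G H) f" "\<delta>' = point_class (oplus G H) f'"
    using assms(3,4) by (meson weil_pointsE)
  have "(\<lambda>z. f i z - f' i z) \<in> weil_ideal (oplus G H)" for i
    using assms(5,6) f G H
    by (intro oplus_ideal_memI smooth_diff)
      (simp_all add: pull_point_class[OF weil_morphism_inj1] pull_point_class[OF weil_morphism_inj2]
        point_class_eq_iff)
  then show ?thesis
    by (simp add: f(3,4) point_class_eq_iff G H)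
qed

lemma Psi_points_eqI:
  assumes \<iota>: "monomial_enum n \<iota>" and "\<delta> \<in> weil_points (oplus (D_eqs (Suc n)) (D_eqs 1))"
    and "\<delta>' \<in> weil_points (oplus (D_eqs (Suc n)) (D_eqs 1))"
    and "pull (D_eqs (Suc n)) (Psi \<iota>) \<delta> = pull (D_eqs (Suc n)) (Psi \<iota>) \<delta>'"
    and "pull (D_eqs (Suc n)) inj1 \<delta> = pull (D_eqs (Suc n)) inj1 \<delta>'"
  shows "\<delta> = \<delta>'"
proof -
  let ?O = "oplus (D_eqs (Suc n)) (D_eqs 1)"
  have size: "size (\<iota> k) = Suc n" for k
    using \<iota> by (auto simp: monomial_enum_def bij_betw_def)
  obtain f f' where f: "\<And>i. smooth (f i)" "\<And>i. smooth (f' i)"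
    "\<delta> = point_class ?O f" "\<delta>' = point_class ?O f'"
    using assms(2,3) by (meson weil_pointsE)
  have "(\<lambda>z. f i z - f' i z) \<in> weil_ideal ?O" for i
    using assms(4,5) f
    by (intro Psi_ideal_memI[OF \<iota>] smooth_diff)
      (simp_all add: pull_point_class[OF weil_morphism_inj1] pull_point_class[OF weil_morphism_Psi[OF size]]
        point_class_eq_iff)
  then show ?thesis
    by (simp add: f(3,4) point_class_eq_iff)
qed

lemma glue_eqI:
  assumes "weil_eqs G" "weil_eqs H" "\<delta> \<in> weil_points (oplus G H)"
    and "pull G inj1 \<delta> = \<gamma>" "pull H inj2 \<delta> = t"
  shows "glue G H \<gamma> t = \<delta>"
  unfolding glue_def using assms oplus_points_eqI[OF assms(1,2)]
  by (intro the_equality) auto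

text \<open>Both \<open>g\<close> and \<open>h\<close> carry the common value at \<open>0\<close>,
  so it is subtracted once; equality of base points is what makes both restrictions come out
  right.\<close>

lemma glue_point_class:
  assumes G: "weil_eqs G" and H: "weil_eqs H" and "\<And>i. smooth (g i)" "\<And>i. smooth (h i)"
    and eq: "\<And>i. g i 0 = h i 0"
  shows "glue G H (point_class G g) (point_class H h) =
    point_class (oplus G H) (\<lambda>i z. g i (fst z) + h i (snd z) - g i 0)"
  using G H
proof (rule glue_eqI)
  show "point_class (oplus G H) (\<lambda>i z. g i (fst z) + h i (snd z) - g i 0) \<in> weil_points (oplus G H)"
    using assms by (intro point_class_in_weil_points smooth_fst_snd)
qed (simp_all add: pull_point_class[OF weil_morphism_inj1[OF G H]]
    pull_point_class[OF weil_morphism_inj2[OF G H]] inj1_def inj2_def eq)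

lemma jet_add_point_class:
  assumes \<iota>: "\<And>k. size (\<iota> k) = Suc n" and "\<And>i. smooth (g i)" "\<And>i. smooth (h i)" "\<And>i. g i 0 = h i 0"
  shows "jet_add n \<iota> (point_class (D_eqs 1) h) (point_class (D_eqs (Suc n)) g) =
    point_class (D_eqs (Suc n)) (\<lambda>i d. g i d + h i (monomials \<iota> d) - g i 0)"
  unfolding jet_add_def using assms(2-)
  by (simp add: glue_point_class pull_point_class[OF weil_morphism_Psi[OF \<iota>]] Psi_def monomials_def)

lemma jet_diff_eqI:
  assumes \<iota>: "monomial_enum n \<iota>" and \<delta>: "\<delta> \<in> weil_points (oplus (D_eqs (Suc n)) (D_eqs 1))"
    and "pull (D_eqs (Suc n)) (Psi \<iota>) \<delta> = \<gamma>" "pull (D_eqs (Suc n)) inj1 \<delta> = \<gamma>'"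
  shows "jet_diff n \<iota> \<gamma> \<gamma>' = pull (D_eqs 1) inj2 \<delta>"
proof -
  have "(THE \<delta>. \<delta> \<in> weil_points (oplus (D_eqs (Suc n)) (D_eqs 1)) \<and>
      pull (D_eqs (Suc n)) (Psi \<iota>) \<delta> = \<gamma> \<and> pull (D_eqs (Suc n)) inj1 \<delta> = \<gamma>') = \<delta>"
    using assms Psi_points_eqI[OF \<iota>] by (intro the_equality) auto
  then show ?thesis
    by (simp add: jet_diff_def)
qed

lemma symb_add_point_class:
  assumes "\<And>i. smooth (g i)" "\<And>i. smooth (h i)" "\<And>i. g i 0 = h i 0"
  shows "symb_add (point_class (D_eqs 1) g) (point_class (D_eqs 1) h) =
    point_class (D_eqs 1) (\<lambda>i e. g i e + h i e - g i 0)"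
  unfolding symb_add_def using assms
  by (simp add: glue_point_class pull_point_class[OF weil_morphism_diagonal[simplified]])

lemma symb_scale_point_class:
  "symb_scale a (point_class (D_eqs 1) h) = point_class (D_eqs 1) (\<lambda>i e. h i (a *\<^sub>R e))"
  unfolding symb_scale_def by (rule pull_point_class[OF weil_morphism_scaleR])

lemma jet_restrict_point_class:
  "jet_restrict n (point_class (D_eqs (Suc n)) f) = point_class (D_eqs n) f"
  unfolding jet_restrict_def by (rule pull_point_class[OF weil_morphism_restrict])

text \<open>Representatives of points over a single point of the base.\<close>

definition vertical :: "('p::finite + 'q::finite \<Rightarrow> 'a::euclidean_space \<Rightarrow> real) \<Rightarrow> bool" where
  "vertical f \<longleftrightarrow> (\<forall>i. smooth (f i)) \<and> (\<forall>i x. f (Inl i) x = f (Inl i) 0)"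

text \<open>Degeneracy makes the components over the base constant only modulo the ideal. Exchanging
  just these representatives for the constants themselves gives a tuple that is constant there on
  the nose.\<close>

lemma degenerate_proj_iff:
  "\<gamma> \<in> weil_points G \<and> degenerate G (proj \<gamma>) \<longleftrightarrow> (\<exists>f. vertical f \<and> \<gamma> = point_class G f)"
proof
  assume L: "\<gamma> \<in> weil_points G \<and> degenerate G (proj \<gamma>)"
  then obtain x where x: "\<And>i. \<gamma> $ Inl i = weil_class G (\<lambda>_. x $ i)"
    by (auto simp: degenerate_def proj_def const_point_def vec_eq_iff)
  from L obtain f where f: "\<And>i. smooth (f i)" "\<gamma> = point_class G f"
    by (auto elim: weil_pointsE)
  define f' where "f' i = (case i of Inl k \<Rightarrow> \<lambda>_. x $ k | Inr _ \<Rightarrow> f i)" for i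
  have "vertical f'"
    by (auto simp: vertical_def f'_def f(1) split: sum.split)
  moreover have "\<gamma> = point_class G f'"
    using x f(2) by (auto simp: vec_eq_iff f'_def split: sum.split)
  ultimately show "\<exists>f. vertical f \<and> \<gamma> = point_class G f"
    by blast
next
  assume "\<exists>f. vertical f \<and> \<gamma> = point_class G f"
  then obtain f where f: "vertical f" "\<gamma> = point_class G f"
    by blast
  have "f (Inl i) = (\<lambda>_. f (Inl i) 0)" for i
    using f(1) by (auto simp: vertical_def)
  then have "weil_class G (f (Inl i)) = weil_class G (\<lambda>_. f (Inl i) 0)" for i
    by (rule arg_cong)
  then have "proj \<gamma> = const_point G (\<chi> i. f (Inl i) 0)"
    by (simp add: f(2) proj_def const_point_def vec_eq_iff)
  moreover have "\<gamma> \<in> weil_points G"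
    using f by (auto simp: vertical_def)
  ultimately show "\<gamma> \<in> weil_points G \<and> degenerate G (proj \<gamma>)"
    by (auto simp: degenerate_def)
qed

lemma jet_iff: "\<gamma> \<in> jet n \<longleftrightarrow> (\<exists>f. vertical f \<and> \<gamma> = point_class (D_eqs n) f)"
  using degenerate_proj_iff by (auto simp: jet_def)

lemma symb_iff: "t \<in> symb \<longleftrightarrow> (\<exists>f. vertical f \<and> t = point_class (D_eqs 1) f)"
  using degenerate_proj_iff by (auto simp: symb_def)

lemma vertical_smooth: "vertical f \<Longrightarrow> smooth (f i)"
  by (simp add: vertical_def)

lemma vertical_compose: "vertical f \<Longrightarrow> smooth_map \<phi> \<Longrightarrow> \<phi> 0 = 0 \<Longrightarrow> vertical (\<lambda>i x. f i (\<phi> x))"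
  unfolding vertical_def by (metis smooth_map_compose)

lemma vertical_add:
  assumes f: "vertical f" and g: "vertical g"
  shows "vertical (\<lambda>i x. f i x + g i x - c i)"
proof -
  have eq: "f (Inl i) x = f (Inl i) 0" "g (Inl i) x = g (Inl i) 0" for i x
    using f g unfolding vertical_def by blast+
  show ?thesis
    unfolding vertical_def
  proof (intro conjI allI)
    show "smooth (\<lambda>x. f i x + g i x - c i)" for i
      by (intro smooth_add smooth_diff smooth_const vertical_smooth f g)
    show "f (Inl i) x + g (Inl i) x - c (Inl i) = f (Inl i) 0 + g (Inl i) 0 - c (Inl i)" for i x
      by (simp only: eq[of i x])
  qed
qed

lemma carrier_symb_jet_fibre:
  assumes "\<gamma> \<in> jet n"
  shows "v \<in> carrier (symb_jet_fibre n \<gamma>) \<longleftrightarrow>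
    (\<exists>h. vertical h \<and> (\<forall>i. h i 0 = base_point \<gamma> $ i) \<and> v = (point_class (D_eqs 1) h, \<gamma>))"
proof -
  have "v \<in> carrier (symb_jet_fibre n \<gamma>) \<longleftrightarrow>
      fst v \<in> symb \<and> base_point (fst v) = base_point \<gamma> \<and> v = (fst v, \<gamma>)"
    using assms by (cases v) (auto simp: symb_jet_fibre_def fibre_def symb_jet_def)
  also have "\<dots> \<longleftrightarrow> (\<exists>h. vertical h \<and> base_point (point_class (D_eqs 1) h) = base_point \<gamma> \<and>
      v = (point_class (D_eqs 1) h, \<gamma>))"
    by (cases v) (auto simp: symb_iff)
  finally show ?thesis
    by (simp add: base_point_class vec_eq_iff[of "\<chi> i. _ i"])
qed

text \<open>The normal form as a pointwise equation, so that it can be evaluated at scaled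
  arguments.\<close>

lemma linear_error_modulo_D1:
  assumes "smooth (h :: real ^ 'k::finite \<Rightarrow> real)"
  obtains r c where "r \<in> weil_ideal (D_eqs 1)" "\<And>e. h e = h 0 + (\<Sum>k\<in>UNIV. c k * e $ k) + r e"
proof -
  obtain c where c: "(\<lambda>e. h e - h 0 - (\<Sum>k\<in>UNIV. c k * e $ k)) \<in> weil_ideal (D_eqs 1)"
    using linear_modulo_D1[OF assms] by blast
  show thesis
    by (rule that[OF c, of c]) simp
qed

text \<open>The affine part of \<open>h\<close> satisfies the identity exactly, and the error
  \<open>r\<close> stays in the ideal under scaling because scaling is a morphism. This gives
  distributivity over sums of scalars.\<close>

lemma scaleR_add_modulo_D1:
  assumes "smooth (h :: real ^ 'k::finite \<Rightarrow> real)"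
  shows "(\<lambda>e. h ((a + b) *\<^sub>R e) - (h (a *\<^sub>R e) + h (b *\<^sub>R e) - h 0)) \<in> weil_ideal (D_eqs 1)"
proof -
  obtain r c where r: "r \<in> weil_ideal (D_eqs 1)" and h: "\<And>e. h e = h 0 + (\<Sum>k\<in>UNIV. c k * e $ k) + r e"
    using linear_error_modulo_D1[OF assms] by blast
  have "h ((a + b) *\<^sub>R e) - (h (a *\<^sub>R e) + h (b *\<^sub>R e) - h 0) =
      r ((a + b) *\<^sub>R e) - r (a *\<^sub>R e) - r (b *\<^sub>R e)" for e
    unfolding h[of "_ *\<^sub>R _"] by (simp add: algebra_simps sum.distrib)
  moreover have "(\<lambda>e. r (a *\<^sub>R e)) \<in> weil_ideal (D_eqs 1)" for a
    by (rule weil_morphism_ideal[OF weil_morphism_scaleR r])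
  ultimately show ?thesis
    by (simp only:) (intro weil_ideal_diff weil_eqs_D)
qed

section \<open>The vector space of symbols over a jet\<close>

lemma cring_real_ring: "cring real_ring"
proof (rule cringI)
  show "abelian_group real_ring"
    by (rule abelian_groupI) (auto simp: real_ring_def intro: exI[of _ "- _"])
  show "Group.comm_monoid real_ring"
    by (rule comm_monoidI) (auto simp: real_ring_def)
qed (auto simp: real_ring_def algebra_simps)

text \<open>Every law is an identity between representatives except \<open>distr\<close>, which
  holds only modulo squares.\<close>

lemma module_symb_jet_fibre:
  fixes \<gamma> :: "(real ^ 'p::finite, 'p + 'q::finite) weil_point"
  assumes \<gamma>: "\<gamma> \<in> jet n"
  shows "Module.module real_ring
    (symb_jet_fibre n \<gamma> :: (real, (real ^ 'k::finite, 'p + 'q) weil_point \<times> _) module)"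
proof -
  let ?V = "symb_jet_fibre n \<gamma> :: (real, (real ^ 'k, 'p + 'q) weil_point \<times> _) module"
  let ?C = "point_class (D_eqs 1) :: ('p + 'q \<Rightarrow> real ^ 'k \<Rightarrow> real) \<Rightarrow> _"
  let ?R = "\<lambda>h :: 'p + 'q \<Rightarrow> real ^ 'k \<Rightarrow> real. vertical h \<and> (\<forall>i. h i 0 = base_point \<gamma> $ i)"
  note carrier = carrier_symb_jet_fibre[OF \<gamma>]
  have ops: "v \<oplus>\<^bsub>?V\<^esub> w = (symb_add (fst v) (fst w), \<gamma>)" "a \<odot>\<^bsub>?V\<^esub> v = (symb_scale a (fst v), \<gamma>)"
    "\<zero>\<^bsub>?V\<^esub> = (?C (\<lambda>i _. base_point \<gamma> $ i), \<gamma>)" for v w a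
    by (simp_all add: symb_jet_fibre_def const_point_eq)
  have add: "(?C g, \<gamma>) \<oplus>\<^bsub>?V\<^esub> (?C h, \<gamma>) = (?C (\<lambda>i e. g i e + h i e - base_point \<gamma> $ i), \<gamma>)"
    if "?R g" "?R h" for g h
    using that by (simp add: ops symb_add_point_class vertical_smooth)
  have smult: "a \<odot>\<^bsub>?V\<^esub> (?C h, \<gamma>) = (?C (\<lambda>i e. h i (a *\<^sub>R e)), \<gamma>)" for a h
    by (simp add: ops symb_scale_point_class)
  have R0: "?R (\<lambda>i _. base_point \<gamma> $ i)"
    by (simp add: vertical_def)
  have Radd: "?R (\<lambda>i e. g i e + h i e - base_point \<gamma> $ i)" if "?R g" "?R h" for g h
    using that by (simp add: vertical_add)
  have Rsmult: "?R (\<lambda>i e. h i (a *\<^sub>R e))" if "?R h" for a h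
    using that vertical_compose[of h "\<lambda>e. a *\<^sub>R e"]
    by (simp add: smooth_map_bounded_linear bounded_linear_scaleR_right)
  have mem: "(?C h, \<gamma>) \<in> carrier ?V" if "?R h" for h
    using that carrier by blast
  have distr: "?C (\<lambda>i e. h i ((a + b) *\<^sub>R e)) = ?C (\<lambda>i e. h i (a *\<^sub>R e) + h i (b *\<^sub>R e) - base_point \<gamma> $ i)"
    if "?R h" for h a b
    unfolding point_class_eq_iff[OF weil_eqs_D]
    using that scaleR_add_modulo_D1[OF vertical_smooth, of h _ a b] by simp
  show ?thesis
  proof (rule moduleI[OF cring_real_ring])
    show "abelian_group ?V"
    proof (rule abelian_groupI)
      show "\<zero>\<^bsub>?V\<^esub> \<in> carrier ?V"
        unfolding ops by (rule mem[OF R0])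
      fix u v assume "u \<in> carrier ?V" "v \<in> carrier ?V"
      then obtain f g where f: "?R f" "u = (?C f, \<gamma>)" and g: "?R g" "v = (?C g, \<gamma>)"
        unfolding carrier by blast
      show "u \<oplus>\<^bsub>?V\<^esub> v \<in> carrier ?V"
        unfolding f(2) g(2) add[OF f(1) g(1)] by (rule mem[OF Radd[OF f(1) g(1)]])
      show "u \<oplus>\<^bsub>?V\<^esub> v = v \<oplus>\<^bsub>?V\<^esub> u"
        unfolding f(2) g(2) add[OF f(1) g(1)] add[OF g(1) f(1)] by (simp add: add.commute)
      show "\<zero>\<^bsub>?V\<^esub> \<oplus>\<^bsub>?V\<^esub> u = u"
        unfolding f(2) ops(3) add[OF R0 f(1)] by simp
      \<comment> \<open>The negative is the scalar multiple by \<open>-1\<close>; that it works is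
        \<open>distr\<close> for the scalars \<open>-1\<close> and \<open>1\<close>, whose sum
        evaluates \<open>f\<close> at the origin.\<close>
      have "(?C (\<lambda>i e. f i ((-1) *\<^sub>R e)), \<gamma>) \<oplus>\<^bsub>?V\<^esub> u = \<zero>\<^bsub>?V\<^esub>"
        unfolding f(2) ops(3) add[OF Rsmult[OF f(1)] f(1)]
        using distr[OF f(1), of "-1" 1] f(1) by simp
      then show "\<exists>w\<in>carrier ?V. w \<oplus>\<^bsub>?V\<^esub> u = \<zero>\<^bsub>?V\<^esub>"
        using mem[OF Rsmult[OF f(1)]] by blast
      fix w assume "w \<in> carrier ?V"
      then obtain h where h: "?R h" "w = (?C h, \<gamma>)"
        unfolding carrier by blast
      show "u \<oplus>\<^bsub>?V\<^esub> v \<oplus>\<^bsub>?V\<^esub> w = u \<oplus>\<^bsub>?V\<^esub> (v \<oplus>\<^bsub>?V\<^esub> w)"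
        unfolding f(2) g(2) h(2) add[OF f(1) g(1)] add[OF g(1) h(1)] add[OF Radd[OF f(1) g(1)] h(1)]
          add[OF f(1) Radd[OF g(1) h(1)]]
        by (simp add: algebra_simps)
    qed
    fix a b :: real and u v assume "u \<in> carrier ?V" "v \<in> carrier ?V"
    then obtain f g where f: "?R f" "u = (?C f, \<gamma>)" and g: "?R g" "v = (?C g, \<gamma>)"
      unfolding carrier by blast
    show "a \<odot>\<^bsub>?V\<^esub> u \<in> carrier ?V"
      unfolding f(2) smult by (rule mem[OF Rsmult[OF f(1)]])
    show "(a \<oplus>\<^bsub>real_ring\<^esub> b) \<odot>\<^bsub>?V\<^esub> u = a \<odot>\<^bsub>?V\<^esub> u \<oplus>\<^bsub>?V\<^esub> b \<odot>\<^bsub>?V\<^esub> u"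
      unfolding f(2) smult add[OF Rsmult[OF f(1)] Rsmult[OF f(1)]]
      using distr[OF f(1), of a b] by (simp add: real_ring_def)
    show "a \<odot>\<^bsub>?V\<^esub> (u \<oplus>\<^bsub>?V\<^esub> v) = a \<odot>\<^bsub>?V\<^esub> u \<oplus>\<^bsub>?V\<^esub> a \<odot>\<^bsub>?V\<^esub> v"
      unfolding f(2) g(2) smult add[OF f(1) g(1)] add[OF Rsmult[OF f(1)] Rsmult[OF g(1)]] ..
    show "(a \<otimes>\<^bsub>real_ring\<^esub> b) \<odot>\<^bsub>?V\<^esub> u = a \<odot>\<^bsub>?V\<^esub> (b \<odot>\<^bsub>?V\<^esub> u)"
      unfolding f(2) smult by (simp add: real_ring_def mult.commute)
    show "\<one>\<^bsub>real_ring\<^esub> \<odot>\<^bsub>?V\<^esub> u = u"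
      unfolding f(2) smult by (simp add: real_ring_def)
  qed
qed

section \<open>Cancellation and the difference of two jets\<close>

context
  fixes n :: nat and \<iota> :: "'k::finite \<Rightarrow> 'p::finite multiset"
  assumes \<iota>: "monomial_enum n \<iota>"
begin

lemma size_monomial_enum: "size (\<iota> k) = Suc n"
  using \<iota> by (auto simp: monomial_enum_def bij_betw_def)

text \<open>The point \<open>?\<delta>\<close> glued to form the sum restricts along
  \<open>Psi\<close> to the sum and along \<open>inj1\<close> to the jet of \<open>g\<close>, so it
  is also the point that defines the difference; its restriction along \<open>inj2\<close> is the
  symbol started from.\<close>

lemma jet_diff_jet_add:
  assumes g: "\<And>i. smooth (g i)" and h: "\<And>i. smooth (h i)" and eq: "\<And>i. g i 0 = h i 0"
  shows "jet_diff n \<iota> (jet_add n \<iota> (point_class (D_eqs 1) h) (point_class (D_eqs (Suc n)) g))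
      (point_class (D_eqs (Suc n)) g) = point_class (D_eqs 1) h"
proof -
  let ?\<delta> = "glue (D_eqs (Suc n)) (D_eqs 1) (point_class (D_eqs (Suc n)) g) (point_class (D_eqs 1) h)"
  have \<delta>: "?\<delta> = point_class (oplus (D_eqs (Suc n)) (D_eqs 1)) (\<lambda>i z. g i (fst z) + h i (snd z) - g i 0)"
    using assms by (intro glue_point_class) auto
  have "jet_diff n \<iota> (jet_add n \<iota> (point_class (D_eqs 1) h) (point_class (D_eqs (Suc n)) g))
      (point_class (D_eqs (Suc n)) g) = pull (D_eqs 1) inj2 ?\<delta>"
  proof (rule jet_diff_eqI[OF \<iota>])
    show "?\<delta> \<in> weil_points (oplus (D_eqs (Suc n)) (D_eqs 1))"
      unfolding \<delta> using g h by (intro point_class_in_weil_points smooth_fst_snd)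
    show "pull (D_eqs (Suc n)) inj1 ?\<delta> = point_class (D_eqs (Suc n)) g"
      unfolding \<delta> by (simp add: pull_point_class[OF weil_morphism_inj1] inj1_def eq)
  qed (simp add: jet_add_def)
  also have "\<dots> = point_class (D_eqs 1) h"
    unfolding \<delta> by (simp add: pull_point_class[OF weil_morphism_inj2] inj2_def eq)
  finally show ?thesis .
qed

lemma jet_diff_point_class:
  fixes f g :: "'p + 'q::finite \<Rightarrow> real ^ 'p \<Rightarrow> real"
  assumes f: "vertical f" and g: "vertical g"
    and fg: "jet_restrict n (point_class (D_eqs (Suc n)) f) = jet_restrict n (point_class (D_eqs (Suc n)) g)"
  obtains h where "vertical h" "\<And>i. h i 0 = g i 0"
    "jet_diff n \<iota> (point_class (D_eqs (Suc n)) f) (point_class (D_eqs (Suc n)) g) = point_class (D_eqs 1) h"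
    "jet_add n \<iota> (point_class (D_eqs 1) h) (point_class (D_eqs (Suc n)) g) = point_class (D_eqs (Suc n)) f"
proof -
  let ?J = "weil_ideal (D_eqs (Suc n))"
  have in_ideal: "(\<lambda>d. f i d - g i d) \<in> weil_ideal (D_eqs n)" for i
    using fg by (simp add: jet_restrict_point_class point_class_eq_iff)
  \<comment> \<open>On components over the base the coefficients are forced to be zero, so that the
    symbol built from them is vertical. This is admissible because \<open>f i\<close> and
    \<open>g i\<close> are constants there, equal since their difference vanishes at
    \<open>0\<close>.\<close>
  have "\<forall>i. \<exists>c. (\<lambda>d. f i d - g i d - (\<Sum>k\<in>UNIV. c k * monomial (\<iota> k) d)) \<in> ?J \<and>
      (i \<in> range Inl \<longrightarrow> c = (\<lambda>_. 0))"
  proof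
    fix i
    show "\<exists>c. (\<lambda>d. f i d - g i d - (\<Sum>k\<in>UNIV. c k * monomial (\<iota> k) d)) \<in> ?J \<and>
        (i \<in> range Inl \<longrightarrow> c = (\<lambda>_. 0))"
    proof (cases "i \<in> range Inl")
      case True
      then have "f i d = f i 0" "g i d = g i 0" for d
        using f g by (auto simp: vertical_def)
      then have "f i d - g i d = 0" for d
        using weil_ideal_at_0[OF weil_eqs_D in_ideal[of i]] by metis
      then show ?thesis
        by (intro exI[of _ "\<lambda>_. 0"]) (simp add: weil_ideal_zero)
    next
      case False
      with leading_coefficients[OF \<iota> in_ideal[of i]] show ?thesis
        by blast
    qed
  qed
  from choice[OF this] obtain c where
    "\<forall>i. (\<lambda>d. f i d - g i d - (\<Sum>k\<in>UNIV. c i k * monomial (\<iota> k) d)) \<in> ?J \<and>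
      (i \<in> range Inl \<longrightarrow> c i = (\<lambda>_. 0))"
    by (rule exE)
  then have c: "(\<lambda>d. f i d - g i d - (\<Sum>k\<in>UNIV. c i k * monomial (\<iota> k) d)) \<in> ?J"
    "c (Inl j) k = 0" for i j k
    by simp_all
  \<comment> \<open>The constant term gives the symbol the base point of the jet of
    \<open>g\<close>, without which the two could not be glued.\<close>
  define h where "h i e = g i 0 + (\<Sum>k\<in>UNIV. c i k * e $ k)" for i e
  have h: "vertical h" "\<And>i. h i 0 = g i 0"
    unfolding vertical_def h_def
    by (auto simp: c(2) intro!: smooth_add smooth_sum smooth_mult smooth_nth)
  have add: "jet_add n \<iota> (point_class (D_eqs 1) h) (point_class (D_eqs (Suc n)) g) = point_class (D_eqs (Suc n)) f"
  proof -
    have "(\<lambda>d. g i d + h i (monomials \<iota> d) - g i 0 - f i d) \<in> ?J" for i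
      using weil_ideal_minus[OF weil_eqs_D c(1)[of i]] by (simp add: h_def algebra_simps)
    then show ?thesis
      using f g h
      by (simp add: jet_add_point_class[OF size_monomial_enum] vertical_smooth point_class_eq_iff)
  qed
  \<comment> \<open>With the jet of \<open>f\<close> recognised as a sum, the difference follows by
    cancellation.\<close>
  have "jet_diff n \<iota> (point_class (D_eqs (Suc n)) f) (point_class (D_eqs (Suc n)) g) = point_class (D_eqs 1) h"
    using jet_diff_jet_add[of g h, OF vertical_smooth[OF g] vertical_smooth[OF h(1)] h(2)[symmetric]]
    unfolding add .
  with h add that show thesis
    by blast
qed

end

text \<open>A vector over \<open>b\<close> has \<open>b\<close> as its second component, so only its
  symbol carries content. All jets over \<open>b\<close> share the base point of \<open>b\<close>;
  the constant removed in each sum is therefore always the same, and iterated sums agree already on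
  representatives.\<close>

theorem theorem66:
  fixes n :: nat and \<iota> :: "'k::finite \<Rightarrow> 'p::finite multiset"
  assumes "monomial_enum n \<iota>"
  shows "affine_bundle
    (jet (Suc n) :: (real ^ 'p, 'p + 'q::finite) weil_point set) (jet_restrict n)
    (symb_jet n :: ((real ^ 'k, 'p + 'q) weil_point \<times> (real ^ 'p, 'p + 'q) weil_point) set) snd
    (jet n) (symb_jet_fibre n)
    (\<lambda>\<gamma> \<gamma>'. (jet_diff n \<iota> \<gamma> \<gamma>', jet_restrict n \<gamma>'))
    (\<lambda>v \<gamma>. jet_add n \<iota> (fst v) \<gamma>)"
proof -
  let ?J = "jet (Suc n) :: (real ^ 'p, 'p + 'q) weil_point set"
  let ?B = "jet n :: (real ^ 'p, 'p + 'q) weil_point set"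
  let ?V = "symb_jet_fibre n :: _ \<Rightarrow> (real, (real ^ 'k, 'p + 'q) weil_point \<times> _) module"
  let ?C = "point_class (D_eqs (Suc n)) :: ('p + 'q \<Rightarrow> real ^ 'p \<Rightarrow> real) \<Rightarrow> _"
  let ?S = "point_class (D_eqs 1) :: ('p + 'q \<Rightarrow> real ^ 'k \<Rightarrow> real) \<Rightarrow> _"
  note size = size_monomial_enum[OF assms]
  have restrict: "jet_restrict n \<in> ?J \<rightarrow> ?B"
  proof
    fix a assume "a \<in> ?J"
    then obtain f where "vertical f" "a = ?C f"
      using jet_iff[of a "Suc n"] by blast
    then show "jet_restrict n a \<in> ?B"
      unfolding jet_iff[of _ n] using jet_restrict_point_class[of n f] by blast
  qed
  have "affine_space (?V b) (fibre ?J (jet_restrict n) b)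
      (\<lambda>\<gamma> \<gamma>'. (jet_diff n \<iota> \<gamma> \<gamma>', jet_restrict n \<gamma>')) (\<lambda>v \<gamma>. jet_add n \<iota> (fst v) \<gamma>)"
    if b: "b \<in> ?B" for b
  proof -
    let ?F = "fibre ?J (jet_restrict n) b"
    let ?R = "\<lambda>h :: 'p + 'q \<Rightarrow> real ^ 'k \<Rightarrow> real. vertical h \<and> (\<forall>i. h i 0 = base_point b $ i)"
    let ?A = "\<lambda>g. vertical g \<and> jet_restrict n (?C g) = b"
    note carrier = carrier_symb_jet_fibre[OF b]
    have F: "a \<in> ?F \<longleftrightarrow> (\<exists>g. ?A g \<and> a = ?C g)" for a
      unfolding fibre_def using jet_iff[of a "Suc n"] by blast
    have base: "g i 0 = base_point b $ i" if "?A g" for g i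
    proof -
      have "b = point_class (D_eqs n) g"
        using that by (simp add: jet_restrict_point_class)
      then show ?thesis
        by (simp add: base_point_class)
    qed
    have add: "jet_add n \<iota> (?S h) (?C g) = ?C (\<lambda>i d. g i d + h i (monomials \<iota> d) - base_point b $ i)"
      if "?R h" "?A g" for g h
      using that base[OF that(2)] by (simp add: jet_add_point_class[OF size] vertical_smooth)
    \<comment> \<open>The monomials have positive degree, so they fix the origin and composing with
      them preserves values at \<open>0\<close>.\<close>
    have "\<iota> k \<noteq> {#}" for k
      using size[of k] by auto
    then have monomials: "smooth_map (monomials \<iota>)" "monomials \<iota> 0 = 0"
      using weil_morphism_monomials[of \<iota> n, OF size]
      by (simp_all add: weil_morphism_def vec_eq_iff monomial_0)
    \<comment> \<open>Adding a symbol does not move the jet out of its fibre: by Hadamard's lemma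
      \<open>h i (monomials \<iota> d)\<close> differs from its constant term by multiples of
      monomials of degree \<open>n + 1\<close>, which are equations of
      \<open>D_eqs n\<close>.\<close>
    have A_add: "?A (\<lambda>i d. g i d + h i (monomials \<iota> d) - base_point b $ i)"
      if h: "?R h" and g: "?A g" for g h
    proof
      show "vertical (\<lambda>i d. g i d + h i (monomials \<iota> d) - base_point b $ i)"
        using h g by (intro vertical_add[of g] vertical_compose[OF _ monomials]) simp_all
      have "(\<lambda>d. h i (monomials \<iota> d) - base_point b $ i) \<in> weil_ideal (D_eqs n)" for i
      proof -
        obtain F where F: "\<And>k. smooth (F k)" "\<And>e. h i e = h i 0 + (\<Sum>k\<in>UNIV. e $ k * F k e)"
          using Hadamard_origin[OF vertical_smooth] h by blast
        have "h i (monomials \<iota> d) - base_point b $ i =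
            (\<Sum>k\<in>UNIV. F k (monomials \<iota> d) * monomial (\<iota> k) d)" for d
          using h F(2)[of "monomials \<iota> d"] by (simp add: mult.commute)
        moreover have "monomial (\<iota> k) \<in> weil_ideal (D_eqs n)" for k
          using size by (intro monomial_in_weil_ideal) simp
        ultimately show ?thesis
          by (simp only:) (intro weil_ideal_sum[OF weil_eqs_D] weil_ideal_mult[OF weil_eqs_D]
            smooth_map_compose[OF F(1) monomials(1)])
      qed
      then have "point_class (D_eqs n) (\<lambda>i d. g i d + h i (monomials \<iota> d) - base_point b $ i) =
          point_class (D_eqs n) g"
        by (simp add: point_class_eq_iff algebra_simps)
      with g show "jet_restrict n (?C (\<lambda>i d. g i d + h i (monomials \<iota> d) - base_point b $ i)) = b"
        by (simp add: jet_restrict_point_class)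
    qed
    show ?thesis
      unfolding affine_space_def
    proof (intro conjI ballI)
      \<comment> \<open>A smooth representative of the jet \<open>b\<close> of order
        \<open>n\<close> also represents a jet of order \<open>n + 1\<close> above it.\<close>
      obtain g where "vertical g" "b = point_class (D_eqs n) g"
        using b jet_iff by blast
      then have "?C g \<in> ?F"
        unfolding F by (auto simp: jet_restrict_point_class)
      then show "?F \<noteq> {}"
        by blast
    next
      fix a a' assume "a \<in> ?F" "a' \<in> ?F"
      then obtain f g where f: "?A f" "a = ?C f" and g: "?A g" "a' = ?C g"
        unfolding F by blast
      obtain h where h: "vertical h" "\<And>i. h i 0 = g i 0" "jet_diff n \<iota> a a' = ?S h"
        "jet_add n \<iota> (?S h) a' = a"
        unfolding f(2) g(2) using jet_diff_point_class[OF assms, of f g] f(1) g(1) by metis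
      show "(jet_diff n \<iota> a a', jet_restrict n a') \<in> carrier (?V b)"
        unfolding carrier using h g base[OF g(1)] by auto
      show "jet_add n \<iota> (fst (jet_diff n \<iota> a a', jet_restrict n a')) a' = a"
        using h by simp
    next
      fix v a assume "v \<in> carrier (?V b)" "a \<in> ?F"
      then obtain h g where h: "?R h" "v = (?S h, b)" and g: "?A g" "a = ?C g"
        unfolding carrier F by blast
      show "jet_add n \<iota> (fst v) a \<in> ?F"
        unfolding F h(2) g(2) fst_conv add[OF h(1) g(1)] using A_add[OF h(1) g(1)] by blast
      show "(jet_diff n \<iota> (jet_add n \<iota> (fst v) a) a, jet_restrict n a) = v"
        unfolding h(2) g(2) using h(1) g(1) base[OF g(1)]
        by (simp add: jet_diff_jet_add[OF assms] vertical_smooth)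
      fix w assume "w \<in> carrier (?V b)"
      then obtain k where k: "?R k" "w = (?S k, b)"
        unfolding carrier by blast
      have "v \<oplus>\<^bsub>?V b\<^esub> w = (?S (\<lambda>i e. h i e + k i e - base_point b $ i), b)"
        using h k by (simp add: symb_jet_fibre_def symb_add_point_class vertical_smooth)
      moreover have "?R (\<lambda>i e. h i e + k i e - base_point b $ i)"
        using h(1) k(1) by (simp add: vertical_add)
      ultimately show "jet_add n \<iota> (fst v) (jet_add n \<iota> (fst w) a) = jet_add n \<iota> (fst (v \<oplus>\<^bsub>?V b\<^esub> w)) a"
        unfolding h(2) k(2) g(2) fst_conv add[OF k(1) g(1)] add[OF h(1) A_add[OF k(1) g(1)]]
        by (simp add: add[OF _ g(1)] algebra_simps)
    next
      fix a assume "a \<in> ?F"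
      then obtain g where g: "?A g" "a = ?C g"
        unfolding F by blast
      have "?R (\<lambda>i _. base_point b $ i)"
        by (simp add: vertical_def)
      from add[OF this g(1)] show "jet_add n \<iota> (fst \<zero>\<^bsub>?V b\<^esub>) a = a"
        by (simp add: symb_jet_fibre_def const_point_eq g(2))
    qed
  qed
  moreover have "snd \<in> symb_jet n \<rightarrow> ?B"
    by (auto simp: symb_jet_def)
  moreover have "carrier (?V b) = fibre (symb_jet n) snd b" for b
    by (simp add: symb_jet_fibre_def)
  ultimately show ?thesis
    unfolding affine_bundle_def vector_bundle_def
    using restrict module_symb_jet_fibre by (intro conjI ballI)
qed

end
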